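(* Let $R>0$ and let $\{(\lambda_n,\mathbf u_n)\}_{n\in\mathbb N}\subset\mathcal Z_{\rm reg}$ be a sequence such that $$\lim_{n\to+\infty}(\lambda_n,\mathbf u_n)=(\lambda,\mathbf u)\quad\text{in }(0,+\infty)\times H^2(\mathbb T,\mathbb R^3),$$ with $(\lambda,\mathbf u)\in\mathcal Z\setminus\mathcal Z_{\rm reg}$. Let $e_{1,n}<e_{2,n}<e_{3,n}$ be the roots associated with $(\lambda_n,\mathbf u_n)$, and let $\mathbf x=\mathbf x_0+\mathbf u$ be the limiting solution, with conserved quantity $C$. Then, after passing to a subsequence, at least one of the following degeneracies occurs: (i) $e_{1,n}\to-R$: the sequence approaches loss of non-polarity through contact with the south pole, and in the limit $C=-\lambda R$. (ii) $e_{2,n}\to R$: the sequence approaches loss of non-polarity through contact with the north pole, and in the limit $C=\lambda R$. (iii) $e_{2,n}-e_{1,n}\to0$: the vertical oscillation collapses, and the limiting solution satisfies $x_3\equiv u_0$ for some constant $u_0\in[-R,R]$. If $|u_0|<R$, then the limiting solution is a constant-latitude solution of the form $$\mathbf x(\eta)=\big(\rho\cos(p\eta+\varphi),\rho\sin(p\eta+\varphi),u_0\big),\qquad \rho=\sqrt{R^2-u_0^2},$$ with $p\in\mathbb Z\setminus\{0\}$ and $u_0=\frac{\lambda(p-1)}{p^2}$. The limiting cases $|u_0|=R$ are the polar constant solutions $\mathbf x\equiv(0,0,R)$ and $\mathbf x\equiv(0,0,-R)$. (iv) $e_{3,n}-e_{2,n}\to0$: the vertical polynomial approaches a double-root degeneration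 at the upper turning level. If this degeneration is not accompanied by collapse of the vertical oscillation, then the limiting vertical dynamics is of separatrix type. Moreover, along a sequence with fixed vertical nodal number and bounded $\lambda$, alternative (iv) can occur only together with alternative (iii). In particular, for a regular branch $\mathscr C_k^{\rm reg}$ ($k\ge2$) bifurcating from the equator, one has $p=1$. Hence, if such a branch reaches the collapse alternative (iii) without simultaneous contact with the poles, then necessarily $u_0=0$. Thus, for $\mathscr C_k^{\rm reg}$ with bounded $\lambda$, the effective boundary alternatives are contact with one of the poles, or collapse back to the equatorial branch $\{(\lambda,0):\lambda>0\}$.
   Context: Fix $R>0$; $\mathbb T=\mathbb R/2\pi\mathbb Z$, $e_3=(0,0,1)$, $\mathbf x_0(\eta)=(R\cos\eta,R\sin\eta,0)$. Zero set. $\mathcal Z$ is the set of $(\lambda,\mathbf u)\in(0,+\infty)\times H^2(\mathbb T,\mathbb R^3)$ such that $\mathbf x=\mathbf x_0+\mathbf u$ is a ($2\pi$-periodic) solution of $\mathbf x\times\mathbf x''-\lambda e_3\times\mathbf x+\lambda\mathbf x'=0$ with $\|\mathbf x\|\equiv R$. Vertical polynomial. For $(\lambda,\mathbf u)\in\mathcal Z$, $\mathbf x=\mathbf x_0+\mathbf u$, the quantities $C=(\mathbf x\times\mathbf x')_3+\lambda x_3$ and $E=\frac\lambda2\|\mathbf x'\|^2+\lambda(x_2x_1'-x_1x_2')$ are constant in $\eta$, and $u=x_3$ satisfies $(u')^2=P(u)$ where $P(s)=a_3s^3-a_2s^2+a_1s+a_0$ with $a_0=\frac{2ER^2-\lambda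 C^2+2\lambda CR^2}{\lambda R^2}$, $a_1=\frac{2\lambda C-2\lambda R^2}{R^2}$, $a_2=\frac{2E+\lambda^3+2\lambda C}{\lambda R^2}$, $a_3=\frac{2\lambda}{R^2}$. Regular class. $\mathcal Z_{\rm reg}\subset\mathcal Z$ is the set of $(\lambda,\mathbf u)$ such that, with $u=x_3$: (1) $-R<u(\eta)<R$ for all $\eta$; (2) $u$ is not constant; (3) with $e_1=\min_{\mathbb T}u$, $e_2=\max_{\mathbb T}u$, the polynomial $P$ has a third real root, the number $e_3$, with $-R<e_1<e_2<R$, $e_2<e_3$, and $P(s)=\frac{2\lambda}{R^2}(s-e_1)(s-e_2)(s-e_3)$. These $e_1<e_2<e_3$ are the roots associated with $(\lambda,\mathbf u)$. Discrete invariants. On $\mathcal Z_{\rm reg}$, the horizontal degree is $p=\frac1{2\pi}\int_0^{2\pi}\frac{x_1x_2'-x_2x_1'}{x_1^2+x_2^2}\,d\eta\in\mathbb Z$, and the vertical nodal number $q\in\mathbb N$ is defined by: the minimal period of $x_3$ is $2\pi/q$. Separatrix type: the limiting polynomial has the form $P(s)=\frac{2\lambda}{R^2}(s-e_1)(s-e_2)^2$ with $e_1<e_2$, so that $\int^{e_2}ds/\sqrt{P(s)}=+\infty$ and the motion between $e_1$ and $e_2$ is not a regular periodic oscillation. Branches $\mathscr C_k^{\rm reg}$. For $k\ge2$ let $\lambda_k=R\sqrt{k^2-1}$, $S=\mathrm{diag}(1,-1,1)$, $Y_{\rm rev}=\{\mathbf u\in H^2(\mathbb T,\mathbb R^3):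 S\mathbf u(-\eta)=\mathbf u(\eta)\}$, $\mathbf v_k(\eta)=\sin(k\eta)(-\sin\eta,\cos\eta,0)-\frac{k}{\sqrt{k^2-1}}\cos(k\eta)\,(0,0,1)$. In a neighbourhood of $(\lambda_k,0)$ in $(0,\infty)\times Y_{\rm rev}$ the elements of $\mathcal Z$ are the trivial ones $(\lambda,0)$ together with a smooth curve $t\mapsto(\Lambda_k(t),\mathbf u_k(t))$, $|t|<\delta$, with $\Lambda_k(0)=\lambda_k$, $\mathbf u_k(t)=t(\mathbf v_k+\Gamma_k(t))$, $\Gamma_k(0)=0$, $\Gamma_k(t)$ being $H^2$-orthogonal to $\mathbf v_k$. $\mathscr C_k^{\rm reg}$ denotes any connected component of $\mathcal Z_{\rm reg}$ containing a point of this curve with $t\ne0$, $|t|$ sufficiently small, or one of its phase translates $(\lambda,\rho_\varphi\mathbf u)$, $(\rho_\varphi\mathbf u)(\eta)=R_\varphi\mathbf u(\eta-\varphi)$, with $R_\varphi$ the rotation of angle $\varphi$ about the $x_3$-axis.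
   Formalization: In the last sentence, collapse back to the equatorial branch {(λ,0)} is proved up to a rotation of the limiting orbit about the x_3-axis; read literally it fails, since rotating orbits of a sequence on the branch tending to (λ_k,0) gives one tending to (λ_k, R_φ x_0 − x_0). *)

theory Defs
  imports "HOL-Analysis.Analysis"
begin

unbundle no cross3_syntax

(* Functions on the circle R/2piZ are 2pi-periodic functions on the real line. *)

definition periodic_2pi :: "(real \<Rightarrow> real^3) \<Rightarrow> bool" where
  "periodic_2pi u \<longleftrightarrow> (\<forall>\<eta>. u (\<eta> + 2*pi) = u \<eta>)"

abbreviation vd :: "(real \<Rightarrow> real^3) \<Rightarrow> real \<Rightarrow> real^3" where
  "vd u \<eta> \<equiv> vector_derivative u (at \<eta>)"

(* w is the L2 weak second derivative of u over one period: u is differentiable and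
   its derivative is the indefinite integral of w. *)
definition has_second_deriv :: "(real \<Rightarrow> real^3) \<Rightarrow> (real \<Rightarrow> real^3) \<Rightarrow> bool" where
  "has_second_deriv u w \<longleftrightarrow>
     (\<forall>\<eta>. u differentiable (at \<eta>)) \<and>
     w \<in> borel_measurable lborel \<and>
     set_integrable lborel {0..2*pi} (\<lambda>\<eta>. (norm (w \<eta>))\<^sup>2) \<and>
     (\<forall>a b. 0 \<le> a \<and> a \<le> b \<and> b \<le> 2*pi \<longrightarrow>
        vd u b - vd u a = set_lebesgue_integral lborel {a..b} w)"

(* In one dimension H2 consists of the C1 functions with absolutely continuous
   derivative and square integrable second derivative (C1 representatives). *)
definition H2 :: "(real \<Rightarrow> real^3) set" where
  "H2 = {u. periodic_2pi u \<and> (\<exists>w. has_second_deriv u w)}"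

(* Determined on [0,2pi] up to null sets. *)
definition d2 :: "(real \<Rightarrow> real^3) \<Rightarrow> real \<Rightarrow> real^3" where
  "d2 u = (SOME w. has_second_deriv u w)"

definition H2_inner :: "(real \<Rightarrow> real^3) \<Rightarrow> (real \<Rightarrow> real^3) \<Rightarrow> real" where
  "H2_inner u v = set_lebesgue_integral lborel {0..2*pi}
     (\<lambda>\<eta>. u \<eta> \<bullet> v \<eta> + vd u \<eta> \<bullet> vd v \<eta> + d2 u \<eta> \<bullet> d2 v \<eta>)"

definition H2_norm :: "(real \<Rightarrow> real^3) \<Rightarrow> real" where
  "H2_norm u = sqrt (H2_inner u u)"

definition H2_dist :: "(real \<Rightarrow> real^3) \<Rightarrow> (real \<Rightarrow> real^3) \<Rightarrow> real" where
  "H2_dist u v = H2_norm (\<lambda>\<eta>. u \<eta> - v \<eta>)"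

definition pair_topology :: "(real \<times> (real \<Rightarrow> real^3)) topology" where
  "pair_topology = Metric_space.mtopology ({0<..} \<times> H2)
     (\<lambda>(l, u) (m, v). \<bar>l - m\<bar> + H2_dist u v)"


definition e_vert :: "real^3" where
  "e_vert = vector [0, 0, 1]"

definition x0 :: "real \<Rightarrow> real \<Rightarrow> real^3" where
  "x0 R \<eta> = vector [R * cos \<eta>, R * sin \<eta>, 0]"

definition orbit :: "real \<Rightarrow> (real \<Rightarrow> real^3) \<Rightarrow> real \<Rightarrow> real^3" where
  "orbit R u \<eta> = x0 R \<eta> + u \<eta>"

definition Z :: "real \<Rightarrow> (real \<times> (real \<Rightarrow> real^3)) set" where
  "Z R = {(l, u). l > 0 \<and> u \<in> H2 \<and>
     (let x = orbit R u in
        (AE \<eta> in lborel. \<eta> \<in> {0..2*pi} \<longrightarrow>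
           cross3 (x \<eta>) (d2 x \<eta>) - l *\<^sub>R cross3 e_vert (x \<eta>) + l *\<^sub>R vd x \<eta> = 0) \<and>
        (\<forall>\<eta>. norm (x \<eta>) = R))}"

definition C_at :: "real \<Rightarrow> (real \<Rightarrow> real^3) \<Rightarrow> real \<Rightarrow> real" where
  "C_at l x \<eta> = cross3 (x \<eta>) (vd x \<eta>) $ 3 + l * x \<eta> $ 3"

definition E_at :: "real \<Rightarrow> (real \<Rightarrow> real^3) \<Rightarrow> real \<Rightarrow> real" where
  "E_at l x \<eta> = l / 2 * (norm (vd x \<eta>))\<^sup>2
     + l * (x \<eta> $ 2 * vd x \<eta> $ 1 - x \<eta> $ 1 * vd x \<eta> $ 2)"

(* C_at and E_at do not depend on the angle along elements of Z, hence the
   evaluation at 0. *)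
definition vert_poly :: "real \<Rightarrow> real \<Rightarrow> (real \<Rightarrow> real^3) \<Rightarrow> real \<Rightarrow> real" where
  "vert_poly R l u s =
     (let C = C_at l (orbit R u) 0;
          E = E_at l (orbit R u) 0;
          a0 = (2 * E * R\<^sup>2 - l * C\<^sup>2 + 2 * l * C * R\<^sup>2) / (l * R\<^sup>2);
          a1 = (2 * l * C - 2 * l * R\<^sup>2) / R\<^sup>2;
          a2 = (2 * E + l^3 + 2 * l * C) / (l * R\<^sup>2);
          a3 = 2 * l / R\<^sup>2
      in a3 * s^3 - a2 * s\<^sup>2 + a1 * s + a0)"

definition is_min_of :: "real \<Rightarrow> (real \<Rightarrow> real) \<Rightarrow> bool" where
  "is_min_of m f \<longleftrightarrow> (\<exists>\<eta>. f \<eta> = m) \<and> (\<forall>\<eta>. m \<le> f \<eta>)"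

definition is_max_of :: "real \<Rightarrow> (real \<Rightarrow> real) \<Rightarrow> bool" where
  "is_max_of m f \<longleftrightarrow> (\<exists>\<eta>. f \<eta> = m) \<and> (\<forall>\<eta>. f \<eta> \<le> m)"

definition assoc_roots ::
  "real \<Rightarrow> real \<Rightarrow> (real \<Rightarrow> real^3) \<Rightarrow> real \<Rightarrow> real \<Rightarrow> real \<Rightarrow> bool" where
  "assoc_roots R l u e1 e2 e3 \<longleftrightarrow>
     is_min_of e1 (\<lambda>\<eta>. orbit R u \<eta> $ 3) \<and> is_max_of e2 (\<lambda>\<eta>. orbit R u \<eta> $ 3) \<and>
     - R < e1 \<and> e1 < e2 \<and> e2 < R \<and> e2 < e3 \<and>
     (\<forall>s. vert_poly R l u s = 2 * l / R\<^sup>2 * (s - e1) * (s - e2) * (s - e3))"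

definition Zreg :: "real \<Rightarrow> (real \<times> (real \<Rightarrow> real^3)) set" where
  "Zreg R = {(l, u). (l, u) \<in> Z R \<and>
     (\<forall>\<eta>. - R < orbit R u \<eta> $ 3 \<and> orbit R u \<eta> $ 3 < R) \<and>
     \<not> (\<exists>c. \<forall>\<eta>. orbit R u \<eta> $ 3 = c) \<and>
     (\<exists>e1 e2 e3. assoc_roots R l u e1 e2 e3)}"

definition horizontal_degree :: "real \<Rightarrow> (real \<Rightarrow> real^3) \<Rightarrow> real" where
  "horizontal_degree R u = (let x = orbit R u in
     1 / (2*pi) * integral {0..2*pi}
       (\<lambda>\<eta>. (x \<eta> $ 1 * vd x \<eta> $ 2 - x \<eta> $ 2 * vd x \<eta> $ 1) / ((x \<eta> $ 1)\<^sup>2 + (x \<eta> $ 2)\<^sup>2)))"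

definition is_nodal_number :: "real \<Rightarrow> (real \<Rightarrow> real^3) \<Rightarrow> nat \<Rightarrow> bool" where
  "is_nodal_number R u q \<longleftrightarrow> q > 0 \<and>
     (let f = (\<lambda>\<eta>. orbit R u \<eta> $ 3); per = (\<lambda>T. T > 0 \<and> (\<forall>\<eta>. f (\<eta> + T) = f \<eta>))
      in per (2*pi / real q) \<and> (\<forall>T. per T \<longrightarrow> 2*pi / real q \<le> T))"


(* Sequences in Zreg, with their roots, that leave Zreg in the limit. *)
definition boundary_sequence ::
  "real \<Rightarrow> (nat \<Rightarrow> real) \<Rightarrow> (nat \<Rightarrow> real \<Rightarrow> real^3) \<Rightarrow> real \<Rightarrow> (real \<Rightarrow> real^3)
     \<Rightarrow> (nat \<Rightarrow> real) \<Rightarrow> (nat \<Rightarrow> real) \<Rightarrow> (nat \<Rightarrow> real) \<Rightarrow> bool" where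
  "boundary_sequence R ls us l u e1 e2 e3 \<longleftrightarrow>
     (\<forall>n. (ls n, us n) \<in> Zreg R \<and> assoc_roots R (ls n) (us n) (e1 n) (e2 n) (e3 n)) \<and>
     ls \<longlonglongrightarrow> l \<and> (\<lambda>n. H2_dist (us n) u) \<longlonglongrightarrow> 0 \<and>
     (l, u) \<in> Z R - Zreg R"

(* The vertical polynomial of (l,u) has a double root at the upper turning level e2.  The
   last two clauses spell out the infinite time needed to reach e2 and the absence of a
   periodic oscillation between the levels e1 and e2. *)
definition separatrix_type ::
  "real \<Rightarrow> real \<Rightarrow> (real \<Rightarrow> real^3) \<Rightarrow> real \<Rightarrow> real \<Rightarrow> bool" where
  "separatrix_type R l u e1 e2 \<longleftrightarrow>
     e1 < e2 \<and>
     (\<forall>s. vert_poly R l u s = 2 * l / R\<^sup>2 * (s - e1) * (s - e2)\<^sup>2) \<and>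
     (\<forall>a. e1 < a \<and> a < e2 \<longrightarrow>
        filterlim (\<lambda>b. integral {a..b} (\<lambda>s. 1 / sqrt (vert_poly R l u s))) at_top (at_left e2)) \<and>
     \<not> (\<exists>f f' T. T > 0 \<and> (\<forall>t. f (t + T) = f t) \<and>
          (\<forall>t. (f has_real_derivative f' t) (at t) \<and> (f' t)\<^sup>2 = vert_poly R l u (f t)) \<and>
          is_min_of e1 f \<and> is_max_of e2 f)"

definition alt_south :: "real \<Rightarrow> real \<Rightarrow> (real \<Rightarrow> real^3) \<Rightarrow> (nat \<Rightarrow> real) \<Rightarrow> bool" where
  "alt_south R l u e1 \<longleftrightarrow> e1 \<longlonglongrightarrow> - R \<and> (\<forall>\<eta>. C_at l (orbit R u) \<eta> = - l * R)"

definition alt_north :: "real \<Rightarrow> real \<Rightarrow> (real \<Rightarrow> real^3) \<Rightarrow> (nat \<Rightarrow> real) \<Rightarrow> bool" where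
  "alt_north R l u e2 \<longleftrightarrow> e2 \<longlonglongrightarrow> R \<and> (\<forall>\<eta>. C_at l (orbit R u) \<eta> = l * R)"

definition alt_collapse ::
  "real \<Rightarrow> real \<Rightarrow> (real \<Rightarrow> real^3) \<Rightarrow> (nat \<Rightarrow> real) \<Rightarrow> (nat \<Rightarrow> real) \<Rightarrow> bool" where
  "alt_collapse R l u e1 e2 \<longleftrightarrow>
     (\<lambda>n. e2 n - e1 n) \<longlonglongrightarrow> 0 \<and>
     (\<exists>u0. - R \<le> u0 \<and> u0 \<le> R \<and> (\<forall>\<eta>. orbit R u \<eta> $ 3 = u0) \<and>
        (\<bar>u0\<bar> < R \<longrightarrow>
           (\<exists>(p::int) \<phi>. p \<noteq> 0 \<and> u0 = l * (real_of_int p - 1) / (real_of_int p)\<^sup>2 \<and>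
              (let \<rho> = sqrt (R\<^sup>2 - u0\<^sup>2) in
                 \<forall>\<eta>. orbit R u \<eta> =
                   vector [\<rho> * cos (real_of_int p * \<eta> + \<phi>), \<rho> * sin (real_of_int p * \<eta> + \<phi>), u0]))) \<and>
        (u0 = R \<longrightarrow> (\<forall>\<eta>. orbit R u \<eta> = vector [0, 0, R])) \<and>
        (u0 = - R \<longrightarrow> (\<forall>\<eta>. orbit R u \<eta> = vector [0, 0, - R])))"

definition alt_double_root ::
  "real \<Rightarrow> real \<Rightarrow> (real \<Rightarrow> real^3) \<Rightarrow> (nat \<Rightarrow> real) \<Rightarrow> (nat \<Rightarrow> real) \<Rightarrow> (nat \<Rightarrow> real) \<Rightarrow> bool" where
  "alt_double_root R l u e1 e2 e3 \<longleftrightarrow>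
     (\<lambda>n. e3 n - e2 n) \<longlonglongrightarrow> 0 \<and>
     (\<not> (\<lambda>n. e2 n - e1 n) \<longlonglongrightarrow> 0 \<longrightarrow>
        (\<exists>m1 m2. e1 \<longlonglongrightarrow> m1 \<and> e2 \<longlonglongrightarrow> m2 \<and> separatrix_type R l u m1 m2))"


definition S_refl :: "real^3 \<Rightarrow> real^3" where
  "S_refl a = vector [a $ 1, - (a $ 2), a $ 3]"

definition Y_rev :: "(real \<Rightarrow> real^3) set" where
  "Y_rev = {u \<in> H2. \<forall>\<eta>. S_refl (u (- \<eta>)) = u \<eta>}"

definition lam_bif :: "real \<Rightarrow> nat \<Rightarrow> real" where
  "lam_bif R k = R * sqrt ((real k)\<^sup>2 - 1)"

definition v_bif :: "nat \<Rightarrow> real \<Rightarrow> real^3" where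
  "v_bif k \<eta> = sin (real k * \<eta>) *\<^sub>R vector [- sin \<eta>, cos \<eta>, 0]
     - (real k / sqrt ((real k)\<^sup>2 - 1) * cos (real k * \<eta>)) *\<^sub>R vector [0, 0, 1]"

definition rot :: "real \<Rightarrow> real^3 \<Rightarrow> real^3" where
  "rot \<phi> a = vector [cos \<phi> * a $ 1 - sin \<phi> * a $ 2, sin \<phi> * a $ 1 + cos \<phi> * a $ 2, a $ 3]"

definition phase_translate :: "real \<Rightarrow> (real \<Rightarrow> real^3) \<Rightarrow> real \<Rightarrow> real^3" where
  "phase_translate \<phi> u \<eta> = rot \<phi> (u (\<eta> - \<phi>))"

definition smooth_real :: "real \<Rightarrow> (real \<Rightarrow> real) \<Rightarrow> bool" where
  "smooth_real \<delta> f \<longleftrightarrow> (\<exists>D. D 0 = f \<and>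
     (\<forall>(j::nat) t. \<bar>t\<bar> < \<delta> \<longrightarrow> (D j has_real_derivative D (Suc j) t) (at t)))"

(* Infinite differentiability of an H2-valued curve with respect to the H2 norm;
   D j is the j-th derivative. *)
definition smooth_H2 :: "real \<Rightarrow> (real \<Rightarrow> real \<Rightarrow> real^3) \<Rightarrow> bool" where
  "smooth_H2 \<delta> F \<longleftrightarrow> (\<exists>D. D 0 = F \<and>
     (\<forall>(j::nat) t. \<bar>t\<bar> < \<delta> \<longrightarrow> D j t \<in> H2 \<and>
        ((\<lambda>h. H2_dist (\<lambda>\<eta>. (1 / h) *\<^sub>R (D j (t + h) \<eta> - D j t \<eta>)) (D (Suc j) t)) \<longlongrightarrow> 0) (at 0)))"

definition bifurcation_curve ::
  "real \<Rightarrow> nat \<Rightarrow> real \<Rightarrow> (real \<Rightarrow> real) \<Rightarrow> (real \<Rightarrow> real \<Rightarrow> real^3) \<Rightarrow> bool" where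
  "bifurcation_curve R k \<delta> L U \<longleftrightarrow>
     \<delta> > 0 \<and> smooth_real \<delta> L \<and> smooth_H2 \<delta> U \<and> L 0 = lam_bif R k \<and>
     (\<forall>t. \<bar>t\<bar> < \<delta> \<longrightarrow> U t \<in> Y_rev \<and> (L t, U t) \<in> Z R) \<and>
     (\<exists>G. smooth_H2 \<delta> G \<and> G 0 = (\<lambda>_. 0) \<and>
        (\<forall>t. \<bar>t\<bar> < \<delta> \<longrightarrow> H2_inner (G t) (v_bif k) = 0 \<and>
           (\<forall>\<eta>. U t \<eta> = t *\<^sub>R (v_bif k \<eta> + G t \<eta>)))) \<and>
     (\<exists>r > 0. \<forall>l u. (l, u) \<in> Z R \<and> u \<in> Y_rev \<and> \<bar>l - lam_bif R k\<bar> < r \<and> H2_norm u < r \<longrightarrow>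
        u = (\<lambda>_. 0) \<or> (\<exists>t. \<bar>t\<bar> < \<delta> \<and> l = L t \<and> u = U t))"

(* A component of Zreg through a point of the curve with 0 < |t| < eps, or through a
   phase translate of such a point (phi = 0 is the point itself). *)
definition regular_branch ::
  "real \<Rightarrow> (real \<Rightarrow> real) \<Rightarrow> (real \<Rightarrow> real \<Rightarrow> real^3) \<Rightarrow> real
     \<Rightarrow> (real \<times> (real \<Rightarrow> real^3)) set \<Rightarrow> bool" where
  "regular_branch R L U \<epsilon> B \<longleftrightarrow>
     B \<in> connected_components_of (subtopology pair_topology (Zreg R)) \<and>
     (\<exists>t \<phi>. t \<noteq> 0 \<and> \<bar>t\<bar> < \<epsilon> \<and> (L t, phase_translate \<phi> (U t)) \<in> B)"

definition equatorial_branch :: "(real \<times> (real \<Rightarrow> real^3)) set" where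
  "equatorial_branch = {(l, u). l > 0 \<and> u = (\<lambda>_. 0)}"

(* The equation is invariant under rotation of the orbit alone, without shift in time, and so
   is every component of Zreg; limits on a branch are determined up to this rotation only,
   which does not fix (l, 0). *)
definition rotate_orbit :: "real \<Rightarrow> real \<Rightarrow> (real \<Rightarrow> real^3) \<Rightarrow> real \<Rightarrow> real^3" where
  "rotate_orbit R \<phi> u \<eta> = rot \<phi> (orbit R u \<eta>) - x0 R \<eta>"

end

theory Submission
  imports Defs
begin

text \<open>
  Along an element of the zero set the moment $x \times x'$ has the classical derivative
  $\lambda e_3 \times x - \lambda x'$; from this $C$ and $E$ are constant and $(u')^2 = P(u)$ holds
  pointwise. Convergence in H2 is uniform convergence of the orbits and their velocities, so
  coefficients, extrema and hence all three roots converge along a boundary sequence, and the limit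
  can only fail to be regular if it touches a pole, is of constant latitude, or has $e_2 = e_3$.
  The function $g = e_3 - u$ satisfies $|g'| \le 2 \sqrt{\lambda/R}\, g$, so Gronwall's inequality
  over one period gives $e_3 - e_1 \le (e_3 - e_2) \exp(4 \pi \sqrt{\lambda/R})$. Thus a
  double root at the upper level always forces collapse, whatever the nodal number, and a separatrix
  never arises as a limit. On the regular class the horizontal degree is an integer that is
  continuous in the C1 topology, so it is constant on components; it equals 1 near the equator, and a
  solution of constant latitude $u_0$ and degree $p$ has $u_0 p^2 = \lambda (p - 1)$.
\<close>

section \<open>Weak second derivatives and the space H2\<close>

text \<open>The velocity of an H2 orbit is only absolutely continuous, so the energy cannot be
  differentiated pointwise in the form in which it is defined. The equation prescribes
  \<open>x \<times> x''\<close> by a continuous function, and on the sphere the moment is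
  \<open>R\<close> times as long as the velocity; so \<open>E\<close>, like \<open>C\<close>, is
  expressed through the moment, which is C1 on a closed period. The constant in the differential
  inequality is what two crude bounds leave: the lowest factor of \<open>P(u)\<close> is bounded by
  the diameter of the sphere and the middle factor by the upper one. The third root is not a height
  of the orbit and could a priori escape; it is recovered from the value of the polynomial at the
  fixed height \<open>R + 1\<close>, which stays away from the two other roots. The degree argument
  is built on uniform convergence of values and velocities alone, so that it applies both to H2
  limits and to phase translates with uncontrolled phases near the equator.\<close>

lemma AE_zero_if_interval_integrals_zero:
  fixes f :: "real \<Rightarrow> 'a::euclidean_space"
  assumes f: "set_integrable lborel {0..T} f" 
    and zero: "\<And>a. 0 \<le> a \<Longrightarrow> a \<le> T \<Longrightarrow> set_lebesgue_integral lborel {a..T} f = 0"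
  shows "AE t in lborel. t \<in> {0..T} \<longrightarrow> f t = 0"
proof -
  define g where "g = (\<lambda>t. indicator {0..T} t *\<^sub>R f t)"
  have g: "integrable lborel g" using f by (simp add: g_def set_integrable_def)
  have gA: "integrable lborel (\<lambda>t. indicator A t *\<^sub>R g t)" if "A \<in> sets borel" for A
    using g that by (intro integrable_mult_indicator) auto
  have gen: "set_lebesgue_integral lborel {a..} g = 0" for a
  proof (cases "a \<le> T")
    case True
    have "set_lebesgue_integral lborel {a..} g = set_lebesgue_integral lborel {max a 0..T} f"
      unfolding set_lebesgue_integral_def g_def
      by (rule Bochner_Integration.integral_cong) (auto simp: indicator_def)
    also have "\<dots> = 0"
    proof (cases "0 \<le> T")
      case True
      then show ?thesis using \<open>a \<le> T\<close> by (intro zero) auto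
    next
      case False
      then have "{max a 0..T} = {}" by auto
      then show ?thesis by (simp add: set_lebesgue_integral_def)
    qed
    finally show ?thesis .
  next
    case False
    then have "(\<lambda>t. indicator {a..} t *\<^sub>R g t) = (\<lambda>_. 0)" 
      by (auto simp: g_def indicator_def fun_eq_iff)
    then show ?thesis by (simp add: set_lebesgue_integral_def)
  qed
  have all0: "integral\<^sup>L lborel g = 0"
  proof -
    have "integral\<^sup>L lborel g = set_lebesgue_integral lborel {0..} g"
      unfolding set_lebesgue_integral_def g_def
      by (rule Bochner_Integration.integral_cong) (auto simp: indicator_def)
    then show ?thesis using gen by simp
  qed
  \<comment> \<open>The half-lines \<open>{a..}\<close> form an intersection-stable generator of the
    Borel sets, so the vanishing of the integrals spreads from them to all Borel sets by Dynkin
    induction.\<close>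
  have G: "set_lebesgue_integral lborel A g = 0" if "A \<in> sets borel" for A
  proof -
    have eq: "{a..} \<inter> {b..} = {max a b..}" for a b :: real by auto
    have "Int_stable (range (atLeast :: real \<Rightarrow> real set))"
      unfolding Int_stable_def by (auto simp: eq)
    moreover have "range (atLeast :: real \<Rightarrow> real set) \<subseteq> Pow UNIV" by simp
    moreover have "A \<in> sigma_sets UNIV (range (atLeast :: real \<Rightarrow> real set))"
      using that unfolding borel_Ici by simp
    ultimately show ?thesis
    proof (induction rule: sigma_sets_induct_disjoint)
      case (basic A) then show ?case using gen by auto
    next
      case empty show ?case by (simp add: set_lebesgue_integral_def)
    next
      case (compl A)
      then have A: "A \<in> sets borel" unfolding borel_Ici by (simp add: sets_measure_of)
      have "set_lebesgue_integral lborel (UNIV - A) g = integral\<^sup>L lborel g - set_lebesgue_integral lborel A g"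
      proof -
        have "(\<lambda>t. indicator (UNIV - A) t *\<^sub>R g t) = (\<lambda>t. g t - indicator A t *\<^sub>R g t)"
          by (auto simp: indicator_def)
        then show ?thesis
          unfolding set_lebesgue_integral_def 
          using Bochner_Integration.integral_diff[OF g gA[OF A]] by simp
      qed
      then show ?case using all0 compl by simp
    next
      case (union A)
      then have A: "A i \<in> sets borel" for i unfolding borel_Ici by (auto simp: sets_measure_of)
      have "set_integrable lborel (\<Union>i. A i) g"
        unfolding set_integrable_def by (intro gA) (use A in auto)
      then have "set_lebesgue_integral lborel (\<Union>i. A i) g = (\<Sum>i. set_lebesgue_integral lborel (A i) g)"
        using A union(1) by (intro lebesgue_integral_countable_add) (auto simp: disjoint_family_on_def)
      then show ?case using union by simp
    qed
  qed
  have "AE t in lborel. g t = 0"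
    by (rule sigma_finite_measure.density_zero[OF lborel.sigma_finite_measure_axioms g]) (use G in auto)
  then show ?thesis by eventually_elim (auto simp: g_def)
qed

section \<open>Calculus of weak second derivatives\<close>

abbreviation l2_sq :: "(real \<Rightarrow> 'a::real_normed_vector) \<Rightarrow> real" where
  "l2_sq f \<equiv> set_lebesgue_integral lborel {0..2*pi} (\<lambda>t. (norm (f t))\<^sup>2)"

text \<open>On a bounded interval square integrability suffices, since
  \<open>n \<le> 1 + n^2\<close> dominates the norm by an integrable function.\<close>

lemma has_second_deriv_integrable:
  assumes "has_second_deriv u w"
  shows "set_integrable lborel {0..2*pi} w"
proof -
  have m[measurable]: "w \<in> borel_measurable lborel" 
    and i: "set_integrable lborel {0..2*pi} (\<lambda>t. (norm (w t))\<^sup>2)"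
    using assms by (auto simp: has_second_deriv_def)
  have "set_integrable lborel {0..2*pi} (\<lambda>t. 1 + (norm (w t))\<^sup>2)"
    by (intro set_integral_add i) (auto intro: borel_integrable_atLeastAtMost')
  then show ?thesis
  proof (rule set_integrable_bound)
    have "norm (w t) \<le> norm (1 + (norm (w t))\<^sup>2)" for t
      using sum_power2_ge_zero[of "norm (w t) - 1" 0]
      by (simp add: power2_eq_square algebra_simps) (smt (verit) norm_ge_zero mult_nonneg_nonneg zero_le_square)
    then show "AE x in lborel. x \<in> {0..2*pi} \<longrightarrow> norm (w x) \<le> norm (1 + (norm (w x))\<^sup>2)" by auto
  qed (simp add: set_borel_measurable_def)
qed

lemma has_second_deriv_integrable_sub:
  assumes "has_second_deriv u w" "0 \<le> a" "b \<le> 2*pi"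
  shows "set_integrable lborel {a..b} w"
  by (rule set_integrable_subset[OF has_second_deriv_integrable[OF assms(1)]]) (use assms in auto)

text \<open>Sums, differences, negatives and multiples are all obtained later by choosing
  \<open>a\<close> and \<open>b\<close> among 1, -1, 0 and a scalar.\<close>

lemma has_second_deriv_lincomb:
  assumes u: "has_second_deriv u w" and v: "has_second_deriv v z"
  shows "has_second_deriv (\<lambda>t. a *\<^sub>R u t + b *\<^sub>R v t) (\<lambda>t. a *\<^sub>R w t + b *\<^sub>R z t)"
    and "vd (\<lambda>t. a *\<^sub>R u t + b *\<^sub>R v t) t = a *\<^sub>R vd u t + b *\<^sub>R vd v t"
proof -
  have du: "\<And>t. u differentiable (at t)" and dv: "\<And>t. v differentiable (at t)"
    using u v by (auto simp: has_second_deriv_def)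
  show eq: "vd (\<lambda>t. a *\<^sub>R u t + b *\<^sub>R v t) t = a *\<^sub>R vd u t + b *\<^sub>R vd v t" for t
    using du dv by (intro vector_derivative_at) (auto intro!: derivative_eq_intros simp: vector_derivative_works[symmetric])
  have mw[measurable]: "w \<in> borel_measurable lborel" "z \<in> borel_measurable lborel"
    and iw: "set_integrable lborel {0..2*pi} (\<lambda>t. (norm (w t))\<^sup>2)"
    and iz: "set_integrable lborel {0..2*pi} (\<lambda>t. (norm (z t))\<^sup>2)"
    using u v by (auto simp: has_second_deriv_def)
  show "has_second_deriv (\<lambda>t. a *\<^sub>R u t + b *\<^sub>R v t) (\<lambda>t. a *\<^sub>R w t + b *\<^sub>R z t)"
    unfolding has_second_deriv_def eq
  proof (intro conjI allI impI)
    fix t show "(\<lambda>t. a *\<^sub>R u t + b *\<^sub>R v t) differentiable at t"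
      using du dv by (auto intro!: derivative_intros)
  next
    have "set_integrable lborel {0..2*pi} (\<lambda>t. (2*a\<^sup>2) * (norm (w t))\<^sup>2 + (2*b\<^sup>2) * (norm (z t))\<^sup>2)"
      by (intro set_integral_add set_integrable_mult_right iw iz)
    then show "set_integrable lborel {0..2*pi} (\<lambda>t. (norm (a *\<^sub>R w t + b *\<^sub>R z t))\<^sup>2)"
    proof (rule set_integrable_bound)
      have "(norm (a *\<^sub>R w t + b *\<^sub>R z t))\<^sup>2 \<le> (2*a\<^sup>2) * (norm (w t))\<^sup>2 + (2*b\<^sup>2) * (norm (z t))\<^sup>2" for t
      proof -
        have "(norm (a *\<^sub>R w t + b *\<^sub>R z t))\<^sup>2 \<le> (norm (a *\<^sub>R w t) + norm (b *\<^sub>R z t))\<^sup>2"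
          by (intro power_mono norm_triangle_ineq) auto
        also have "\<dots> \<le> 2 * (norm (a *\<^sub>R w t))\<^sup>2 + 2 * (norm (b *\<^sub>R z t))\<^sup>2"
          using sum_squares_bound[of "norm (a *\<^sub>R w t)" "norm (b *\<^sub>R z t)"] by (simp add: power2_sum)
        finally show ?thesis by (simp add: power_mult_distrib)
      qed
      then show "AE t in lborel. t \<in> {0..2*pi} \<longrightarrow> norm ((norm (a *\<^sub>R w t + b *\<^sub>R z t))\<^sup>2)
         \<le> norm ((2*a\<^sup>2) * (norm (w t))\<^sup>2 + (2*b\<^sup>2) * (norm (z t))\<^sup>2)" by simp
    qed (simp add: set_borel_measurable_def)
  next
    fix c d :: real assume *: "0 \<le> c \<and> c \<le> d \<and> d \<le> 2 * pi"
    have i: "set_integrable lborel {c..d} w" "set_integrable lborel {c..d} z"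
      using * has_second_deriv_integrable_sub u v by auto
    have "vd u d - vd u c = set_lebesgue_integral lborel {c..d} w" "vd v d - vd v c = set_lebesgue_integral lborel {c..d} z"
      using u v * by (auto simp: has_second_deriv_def)
    then show "a *\<^sub>R vd u d + b *\<^sub>R vd v d - (a *\<^sub>R vd u c + b *\<^sub>R vd v c) =
       set_lebesgue_integral lborel {c..d} (\<lambda>t. a *\<^sub>R w t + b *\<^sub>R z t)"
      using i by (simp add: set_integrable_scaleR_right) (simp add: algebra_simps flip: scaleR_diff_right)
  qed simp
qed

text \<open>Both candidates have the same integral over every \<open>{a..2*pi}\<close>. This frees
  the H2 norm from the arbitrary choice made by \<open>SOME\<close> in \<open>d2\<close>.\<close>

lemma has_second_deriv_unique:
  assumes u: "has_second_deriv u w" and v: "has_second_deriv u z"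
  shows "AE t in lborel. t \<in> {0..2*pi} \<longrightarrow> w t = z t"
proof -
  have "AE t in lborel. t \<in> {0..2*pi} \<longrightarrow> w t - z t = 0"
  proof (rule AE_zero_if_interval_integrals_zero)
    show "set_integrable lborel {0..2*pi} (\<lambda>t. w t - z t)"
      by (intro set_integral_diff has_second_deriv_integrable[OF u] has_second_deriv_integrable[OF v])
    fix a :: real assume a: "0 \<le> a" "a \<le> 2*pi"
    have i: "set_integrable lborel {a..2*pi} w" "set_integrable lborel {a..2*pi} z"
      using a has_second_deriv_integrable_sub u v by auto
    have "vd u (2*pi) - vd u a = set_lebesgue_integral lborel {a..2*pi} w" "vd u (2*pi) - vd u a = set_lebesgue_integral lborel {a..2*pi} z"
      using u v a by (auto simp: has_second_deriv_def)
    then show "set_lebesgue_integral lborel {a..2*pi} (\<lambda>t. w t - z t) = 0"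
      using i by simp
  qed
  then show ?thesis by eventually_elim auto
qed

lemma has_second_deriv_d2: "has_second_deriv u w \<Longrightarrow> has_second_deriv u (d2 u)"
  using someI[of "has_second_deriv u"] by (simp add: d2_def)

lemma H2_d2: "u \<in> H2 \<Longrightarrow> has_second_deriv u (d2 u)"
  using has_second_deriv_d2 by (auto simp: H2_def)

lemma H2_lincomb:
  assumes "u \<in> H2" "v \<in> H2" shows "(\<lambda>t. a *\<^sub>R u t + b *\<^sub>R v t) \<in> H2"
  using assms has_second_deriv_lincomb(1)[of u _ v _ a b]
  by (fastforce simp: H2_def periodic_2pi_def)

lemma H2_diff: "u \<in> H2 \<Longrightarrow> v \<in> H2 \<Longrightarrow> (\<lambda>t. u t - v t) \<in> H2"
  using H2_lincomb[of u v 1 "-1"] by simp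

lemma H2_add: "u \<in> H2 \<Longrightarrow> v \<in> H2 \<Longrightarrow> (\<lambda>t. u t + v t) \<in> H2"
  using H2_lincomb[of u v 1 "1"] by simp

lemma H2_differentiable: "u \<in> H2 \<Longrightarrow> u differentiable (at t)"
  by (auto simp: H2_def has_second_deriv_def)

lemma H2_has_vd: "u \<in> H2 \<Longrightarrow> (u has_vector_derivative vd u t) (at t)"
  using H2_differentiable vector_derivative_works by blast

lemma H2_periodic: "u \<in> H2 \<Longrightarrow> u (t + 2*pi) = u t"
  by (auto simp: H2_def periodic_2pi_def)

lemma H2_vd_periodic: assumes "u \<in> H2" shows "vd u (t + 2*pi) = vd u t"
proof -
  have "(u has_vector_derivative vd u (t + 2*pi)) (at (2*pi + t))"
    using H2_has_vd[OF assms] by (simp add: add.commute)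
  then have "((u \<circ> (\<lambda>s. 2*pi + s)) has_vector_derivative vd u (t + 2*pi)) (at t)"
    by (rule vector_diff_chain_at[OF _ _, THEN has_vector_derivative_eq_rhs, rotated 1]) (auto intro!: derivative_eq_intros)
  moreover have "u \<circ> (\<lambda>s. 2*pi + s) = u"
    using H2_periodic[OF assms] by (auto simp: add.commute)
  ultimately show ?thesis by (simp add: vector_derivative_at)
qed

section \<open>Reduction to one period\<close>

lemma periodic_shift_int:
  assumes "\<And>t. f (t + 2*pi) = f (t::real)" shows "f (t + 2*pi * of_int n) = f t"
proof (induction n rule: int_induct[where k=0])
  case base then show ?case by simp
next
  case (step1 i) then show ?case using assms[of "t + 2*pi * of_int i"] by (simp add: algebra_simps)
next
  case (step2 i) then show ?case using assms[of "t + 2*pi * of_int (i - 1)"] by (simp add: algebra_simps)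
qed

lemma shift_into_period: "\<exists>n::int. t + 2*pi * of_int n \<in> {0..2*pi}"
proof -
  define n where "n = - \<lfloor>t / (2*pi)\<rfloor>"
  have "0 \<le> t / (2*pi) + of_int n" "t / (2*pi) + of_int n \<le> 1"
    unfolding n_def by (auto, linarith)
  then have *: "0 * (2*pi) \<le> (t / (2*pi) + of_int n) * (2*pi)" "(t / (2*pi) + of_int n) * (2*pi) \<le> 1 * (2*pi)"
    by (intro mult_right_mono; simp)+
  then show ?thesis unfolding distrib_right by (intro exI[of _ n]) (simp add: mult.commute mult.left_commute)
qed

section \<open>Embedding of H2 into C1\<close>

text \<open>Young's inequality \<open>n \<le> M/2 + n^2/(2 M)\<close> takes the place of
  Cauchy-Schwarz; over the length \<open>2 pi\<close> it yields \<open>(pi + 1/2) M\<close>, and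
  \<open>pi \<le> 7/2\<close>.\<close>

lemma integral_norm_le_of_l2_sq_le:
  fixes f :: "real \<Rightarrow> 'a::euclidean_space"
  assumes f: "set_integrable lborel {0..2*pi} f"
    and f2: "set_integrable lborel {0..2*pi} (\<lambda>t. (norm (f t))\<^sup>2)"
    and M: "M > 0" "l2_sq f \<le> M\<^sup>2"
  shows "(LBINT t:{0..2*pi}. norm (f t)) \<le> 4 * M"
proof -
  have c: "set_integrable lborel {0..2*pi} (\<lambda>t::real. M / 2)"
    by (rule borel_integrable_atLeastAtMost') auto
  have "(LBINT t:{0..2*pi}. norm (f t)) \<le> (LBINT t:{0..2*pi}. M / 2 + (1 / (2*M)) * (norm (f t))\<^sup>2)"
  proof (rule set_integral_mono)
    show "set_integrable lborel {0..2*pi} (\<lambda>t. norm (f t))"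
      using f by (rule set_integrable_norm)
    show "set_integrable lborel {0..2*pi} (\<lambda>t. M / 2 + (1 / (2*M)) * (norm (f t))\<^sup>2)"
      by (intro set_integral_add set_integrable_mult_right c f2)
    show "norm (f t) \<le> M / 2 + (1 / (2*M)) * (norm (f t))\<^sup>2" for t
      using M(1) sum_squares_bound[of M "norm (f t)"] by (simp add: field_simps power2_eq_square)
  qed
  also have "\<dots> = (LBINT t:{0..2*pi}. M / 2) + (1 / (2*M)) * l2_sq f"
    by (subst set_integral_add(2)) (use c f2 in auto)
  also have "(LBINT t:{0..2*pi}. M / 2) = pi * M"
    using pi_gt_zero by (simp add: set_lebesgue_integral_def)
  also have "(1 / (2*M)) * l2_sq f \<le> (1 / (2*M)) * M\<^sup>2"
    using M by (intro mult_left_mono) auto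
  also have "pi * M + (1 / (2*M)) * M\<^sup>2 \<le> 4 * M"
  proof -
    have "pi \<le> 7 / 2" using pi_approx by simp
    then have "pi * M \<le> 7 / 2 * M" using M(1) by (intro mult_right_mono) auto
    moreover have "(1 / (2*M)) * M\<^sup>2 = M / 2" using M(1) by (simp add: power2_eq_square)
    ultimately show ?thesis by linarith
  qed
  finally show ?thesis by simp
qed

text \<open>The one-dimensional Sobolev embedding. The function varies by at most the integral of
  \<open>norm (g t)\<close>, hence by \<open>4 * M\<close>, and its mean norm is at most
  \<open>4 * M / (2 * pi) \<le> M\<close>; the sum is the constant 5.\<close>

lemma sobolev_bound:
  fixes f g :: "real \<Rightarrow> 'a::euclidean_space"
  assumes f: "set_integrable lborel {0..2*pi} f" 
    and f2: "set_integrable lborel {0..2*pi} (\<lambda>t. (norm (f t))\<^sup>2)"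
    and g: "set_integrable lborel {0..2*pi} g" 
    and g2: "set_integrable lborel {0..2*pi} (\<lambda>t. (norm (g t))\<^sup>2)"
    and fg: "\<And>a b. 0 \<le> a \<Longrightarrow> a \<le> b \<Longrightarrow> b \<le> 2*pi \<Longrightarrow> f b - f a = set_lebesgue_integral lborel {a..b} g"
    and M: "M > 0" "l2_sq f \<le> M\<^sup>2" "l2_sq g \<le> M\<^sup>2"
    and t: "t \<in> {0..2*pi}"
  shows "norm (f t) \<le> 5 * M"
proof -
  have G: "(LBINT t:{0..2*pi}. norm (g t)) \<le> 4 * M"
    by (rule integral_norm_le_of_l2_sq_le[OF g g2 M(1,3)])
  have incr: "norm (f b - f a) \<le> 4 * M" if "0 \<le> a" "a \<le> b" "b \<le> 2*pi" for a b
  proof -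
    have i: "set_integrable lborel {a..b} (\<lambda>t. norm (g t))"
      by (rule set_integrable_subset[OF set_integrable_norm[OF g]]) (use that in auto)
    have "norm (f b - f a) \<le> (LBINT t:{a..b}. norm (g t))"
      unfolding fg[OF that] by (rule set_integral_norm_bound) 
         (rule set_integrable_subset[OF g], use that in auto)
    also have "\<dots> \<le> (LBINT t:{0..2*pi}. norm (g t))"
      using set_integrable_norm[OF g] i that
      unfolding set_lebesgue_integral_def set_integrable_def
      by (intro integral_mono) (auto simp: indicator_def)
    finally show ?thesis using G by simp
  qed
  have le: "norm (f t) - 4 * M \<le> norm (f s)" if "s \<in> {0..2*pi}" for s
    using incr[of s t] incr[of t s] t that norm_triangle_ineq2[of "f t" "f s"] norm_minus_commute[of "f t" "f s"]
    by (cases "s \<le> t") auto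
  have "2 * pi * (norm (f t) - 4 * M) = (LBINT s:{0..2*pi}. norm (f t) - 4 * M)"
    using pi_gt_zero by (simp add: set_lebesgue_integral_def)
  also have "\<dots> \<le> (LBINT s:{0..2*pi}. norm (f s))"
    by (rule set_integral_mono) (use le set_integrable_norm[OF f] in \<open>auto intro: borel_integrable_atLeastAtMost'\<close>)
  also have "\<dots> \<le> 4 * M" by (rule integral_norm_le_of_l2_sq_le[OF f f2 M(1,2)])
  also have "\<dots> \<le> 2 * pi * M" using M(1) pi_ge_two by simp
  finally have "2 * pi * (norm (f t) - 4 * M) \<le> 2 * pi * M" .
  then show ?thesis by simp
qed

lemma has_second_deriv_continuous: "has_second_deriv u w \<Longrightarrow> continuous_on S u"
  by (auto simp: has_second_deriv_def intro!: continuous_at_imp_continuous_on differentiable_imp_continuous_within)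

lemma has_second_deriv_vd_continuous:
  assumes w: "has_second_deriv u w" shows "continuous_on {0..2*pi} (vd u)"
proof -
  have int: "w integrable_on {0..2*pi}"
    using has_second_deriv_integrable[OF w] by (rule set_borel_integral_eq_integral)
  have eq: "vd u 0 + integral {0..t} w = vd u t" if "t \<in> {0..2*pi}" for t
  proof -
    have "set_integrable lborel {0..t} w"
      using that by (intro has_second_deriv_integrable_sub[OF w]) auto
    moreover have "vd u t - vd u 0 = set_lebesgue_integral lborel {0..t} w"
      using w that by (auto simp: has_second_deriv_def)
    ultimately show ?thesis using set_borel_integral_eq_integral(2) by (metis add.commute diff_add_cancel)
  qed
  have "continuous_on {0..2*pi} (\<lambda>t. vd u 0 + integral {0..t} w)"
    by (intro continuous_intros indefinite_integral_continuous_1 int)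
  then show ?thesis using eq by (rule continuous_on_eq)
qed

lemmas H2_continuous = has_second_deriv_continuous[OF H2_d2]
lemmas H2_vd_continuous = has_second_deriv_vd_continuous[OF H2_d2]

lemma has_second_deriv_l2_integrable:
  assumes "has_second_deriv u w"
  shows "set_integrable lborel {0..2*pi} (\<lambda>t. (norm (u t))\<^sup>2)"
    and "set_integrable lborel {0..2*pi} (\<lambda>t. (norm (vd u t))\<^sup>2)"
    and "set_integrable lborel {0..2*pi} (\<lambda>t. (norm (w t))\<^sup>2)"
proof -
  show "set_integrable lborel {0..2*pi} (\<lambda>t. (norm (u t))\<^sup>2)"
    by (intro borel_integrable_atLeastAtMost' continuous_intros has_second_deriv_continuous[OF assms])
  show "set_integrable lborel {0..2*pi} (\<lambda>t. (norm (vd u t))\<^sup>2)"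
    by (intro borel_integrable_atLeastAtMost' continuous_intros has_second_deriv_vd_continuous[OF assms])
  show "set_integrable lborel {0..2*pi} (\<lambda>t. (norm (w t))\<^sup>2)"
    using assms by (simp add: has_second_deriv_def)
qed

section \<open>The H2 norm and its metric\<close>

lemma l2_sq_nonneg: "0 \<le> l2_sq f"
  unfolding set_lebesgue_integral_def by (intro Bochner_Integration.integral_nonneg) auto

lemma H2_norm_nonneg: "0 \<le> H2_norm u"
  unfolding H2_norm_def H2_inner_def set_lebesgue_integral_def
  by (intro real_sqrt_ge_zero Bochner_Integration.integral_nonneg) (simp add: inner_ge_zero)

lemma H2_norm_sq:
  assumes w: "has_second_deriv u w"
  shows "(H2_norm u)\<^sup>2 = l2_sq u + l2_sq (vd u) + l2_sq w"
proof -
  have w': "has_second_deriv u (d2 u)" by (rule has_second_deriv_d2[OF w])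
  note i = has_second_deriv_l2_integrable[OF w'] 
  have [measurable]: "w \<in> borel_measurable lborel" "d2 u \<in> borel_measurable lborel"
    using w w' by (auto simp: has_second_deriv_def)
  have "l2_sq (d2 u) = l2_sq w"
    using has_second_deriv_unique[OF w' w] by (intro set_lebesgue_integral_cong_AE) auto
  moreover have "H2_inner u u = l2_sq u + l2_sq (vd u) + l2_sq (d2 u)"
    unfolding H2_inner_def power2_norm_eq_inner[symmetric] using i by (simp add: set_integral_add)
  ultimately have eq: "H2_inner u u = l2_sq u + l2_sq (vd u) + l2_sq w" by simp
  then have "H2_inner u u \<ge> 0" by (simp add: l2_sq_nonneg)
  then show ?thesis by (simp add: H2_norm_def eq)
qed

text \<open>The embedding is applied twice, to \<open>u\<close> with its derivative and to
  \<open>vd u\<close> with \<open>d2 u\<close>. The strict inequality makes \<open>M\<close>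
  positive even for a vanishing norm, as the division in Young's inequality requires.\<close>

lemma H2_sup_bound:
  assumes u: "u \<in> H2" and M: "H2_norm u < M"
  shows "norm (u t) \<le> 5 * M" "norm (vd u t) \<le> 5 * M"
proof -
  have w: "has_second_deriv u (d2 u)" by (rule H2_d2[OF u])
  have Mpos: "M > 0" using H2_norm_nonneg[of u] M by linarith
  have le: "(H2_norm u)\<^sup>2 \<le> M\<^sup>2" using M by (intro power_mono H2_norm_nonneg) auto
  then have l: "l2_sq u \<le> M\<^sup>2" "l2_sq (vd u) \<le> M\<^sup>2" "l2_sq (d2 u) \<le> M\<^sup>2"
    unfolding H2_norm_sq[OF w] using l2_sq_nonneg[of u] l2_sq_nonneg[of "vd u"] l2_sq_nonneg[of "d2 u"] by linarith+
  note i = has_second_deriv_l2_integrable[OF w]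
  have iu: "set_integrable lborel {0..2*pi} u" "set_integrable lborel {0..2*pi} (vd u)"
    using H2_continuous[OF u] H2_vd_continuous[OF u] by (auto intro: borel_integrable_atLeastAtMost')
  have ftc: "u b - u a = set_lebesgue_integral lborel {a..b} (vd u)" if "0 \<le> a" "a \<le> b" "b \<le> 2*pi" for a b
  proof -
    have "continuous_on {a..b} (vd u)"
      by (rule continuous_on_subset[OF H2_vd_continuous[OF u]]) (use that in auto)
    then have "set_lebesgue_integral lborel {a..b} (vd u) = integral {a..b} (vd u)"
      by (intro set_borel_integral_eq_integral borel_integrable_atLeastAtMost')
    moreover have "(vd u has_integral (u b - u a)) {a..b}"
      using that H2_has_vd[OF u] by (intro fundamental_theorem_of_calculus) (auto intro: has_vector_derivative_at_within)
    ultimately show ?thesis by (simp add: integral_unique)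
  qed
  obtain n :: int where n: "t + 2*pi * of_int n \<in> {0..2*pi}" using shift_into_period by blast
  have "norm (u (t + 2*pi * of_int n)) \<le> 5 * M"
    by (rule sobolev_bound[OF iu(1) i(1) iu(2) i(2) ftc Mpos l(1,2) n])
  then show "norm (u t) \<le> 5 * M" using periodic_shift_int[of u t n] H2_periodic[OF u] by simp
  have "norm (vd u (t + 2*pi * of_int n)) \<le> 5 * M"
    by (rule sobolev_bound[OF iu(2) i(2) has_second_deriv_integrable[OF w] i(3) _ Mpos l(2,3) n])
       (use w in \<open>auto simp: has_second_deriv_def\<close>)
  then show "norm (vd u t) \<le> 5 * M" using periodic_shift_int[of "vd u" t n] H2_vd_periodic[OF u] by simp
qed

text \<open>Young's inequality with a free weight, from \<open>(c n - k)^2 / c \<ge> 0\<close>. One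
  weight shared by the three parts of the H2 norm yields its triangle inequality.\<close>

lemma l2_sq_add_le:
  fixes f g :: "real \<Rightarrow> 'a::real_normed_vector"
  assumes f: "set_integrable lborel {0..2*pi} (\<lambda>t. (norm (f t))\<^sup>2)"
    and g: "set_integrable lborel {0..2*pi} (\<lambda>t. (norm (g t))\<^sup>2)"
    and fg: "set_integrable lborel {0..2*pi} (\<lambda>t. (norm (f t + g t))\<^sup>2)"
    and c: "c > 0"
  shows "l2_sq (\<lambda>t. f t + g t) \<le> (1 + c) * l2_sq f + (1 + 1 / c) * l2_sq g"
proof -
  have "l2_sq (\<lambda>t. f t + g t) \<le> (LBINT t:{0..2*pi}. (1 + c) * (norm (f t))\<^sup>2 + (1 + 1 / c) * (norm (g t))\<^sup>2)"
  proof (rule set_integral_mono)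
    fix t
    have "(norm (f t + g t))\<^sup>2 \<le> (norm (f t) + norm (g t))\<^sup>2"
      by (intro power_mono norm_triangle_ineq) auto
    moreover have "0 \<le> (c * norm (f t) - norm (g t))\<^sup>2 / c" using c by simp
    moreover have "(c * norm (f t) - norm (g t))\<^sup>2 / c = c * (norm (f t))\<^sup>2 - 2 * norm (f t) * norm (g t) + (norm (g t))\<^sup>2 / c"
      using c by (simp add: power2_eq_square field_simps)
    ultimately show "(norm (f t + g t))\<^sup>2 \<le> (1 + c) * (norm (f t))\<^sup>2 + (1 + 1 / c) * (norm (g t))\<^sup>2"
      by (simp add: power2_sum algebra_simps)
  qed (intro fg set_integral_add set_integrable_mult_right f g)+
  also have "\<dots> = (1 + c) * l2_sq f + (1 + 1 / c) * l2_sq g"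
    by (subst set_integral_add(2)) (use f g in auto)
  finally show ?thesis .
qed

lemma H2_norm_triangle:
  assumes u: "u \<in> H2" and v: "v \<in> H2"
  shows "H2_norm (\<lambda>t. u t + v t) \<le> H2_norm u + H2_norm v"
proof (rule field_le_epsilon)
  fix e :: real assume e: "e > 0"
  \<comment> \<open>The summand \<open>e / 2\<close> keeps \<open>a\<close> and \<open>b\<close>
    positive when a norm vanishes, so that their quotient can serve as the weight.\<close>
  define a where "a = H2_norm u + e / 2"
  define b where "b = H2_norm v + e / 2"
  have w: "has_second_deriv u (d2 u)" "has_second_deriv v (d2 v)" using H2_d2 u v by auto
  have w': "has_second_deriv (\<lambda>t. u t + v t) (\<lambda>t. d2 u t + d2 v t)"
    and vd': "vd (\<lambda>t. u t + v t) t = vd u t + vd v t" for t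
    using has_second_deriv_lincomb[OF w, of 1 1] by auto
  note N = H2_norm_sq[OF w(1)] H2_norm_sq[OF w(2)] H2_norm_sq[OF w']
  note i = has_second_deriv_l2_integrable[OF w(1)] has_second_deriv_l2_integrable[OF w(2)] 
    has_second_deriv_l2_integrable[OF w', unfolded vd']
  have ab: "a > 0" "b > 0" using H2_norm_nonneg e by (auto simp: a_def b_def add_nonneg_pos)
  \<comment> \<open>The optimal weight: it turns \<open>(1 + c) a^2 + (1 + 1/c) b^2\<close> into
    \<open>(a + b)^2\<close>.\<close>
  define c where "c = b / a"
  have c: "c > 0" using ab by (simp add: c_def)
  have "(H2_norm (\<lambda>t. u t + v t))\<^sup>2 \<le> (1 + c) * (H2_norm u)\<^sup>2 + (1 + 1 / c) * (H2_norm v)\<^sup>2"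
    unfolding N vd' 
    using l2_sq_add_le[OF i(1,4,7) c] l2_sq_add_le[OF i(2,5,8) c] l2_sq_add_le[OF i(3,6,9) c]
    by (simp add: distrib_left)
  also have "\<dots> \<le> (1 + c) * a\<^sup>2 + (1 + 1 / c) * b\<^sup>2"
    using c e H2_norm_nonneg unfolding a_def b_def by (intro add_mono mult_left_mono power_mono) auto
  also have "\<dots> = (a + b)\<^sup>2" using ab by (simp add: c_def power2_eq_square field_simps)
  finally have "H2_norm (\<lambda>t. u t + v t) \<le> a + b" by (rule power2_le_imp_le) (use ab in simp)
  then show "H2_norm (\<lambda>t. u t + v t) \<le> H2_norm u + H2_norm v + e" by (simp add: a_def b_def)
qed

text \<open>
  Metric spaces in the library require symmetry of the distance on the whole type, so functions
  outside H2 have to be covered; there the choice operators in the derivatives return the same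
  junk value for u and - u.
\<close>

lemma H2_norm_minus: "H2_norm (\<lambda>t. - u t) = H2_norm u"
proof (cases "\<exists>w. has_second_deriv u w")
  case True
  then have w: "has_second_deriv u (d2 u)" using has_second_deriv_d2 by blast
  have w': "has_second_deriv (\<lambda>t. - u t) (\<lambda>t. - d2 u t)" and vd': "vd (\<lambda>t. - u t) t = - vd u t" for t
    using has_second_deriv_lincomb[OF w w, of "-1" 0] by auto
  have "(H2_norm (\<lambda>t. - u t))\<^sup>2 = (H2_norm u)\<^sup>2"
    unfolding H2_norm_sq[OF w] H2_norm_sq[OF w'] by (simp add: vd')
  then show ?thesis using H2_norm_nonneg by (simp add: power2_eq_iff_nonneg)
next
  case False
  have False': "\<not> has_second_deriv (\<lambda>t. - u t) w" for w
  proof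
    assume w: "has_second_deriv (\<lambda>t. - u t) w"
    show False using has_second_deriv_lincomb(1)[OF w w, of "-1" 0] False by auto
  qed
  have d2: "d2 (\<lambda>t. - u t) = d2 u" 
  proof -
    have "has_second_deriv (\<lambda>t. - u t) = has_second_deriv u" using False False' by blast
    then show ?thesis by (simp add: d2_def)
  qed
  have vd: "vd (\<lambda>t. - u t) t \<bullet> vd (\<lambda>t. - u t) t = vd u t \<bullet> vd u t" for t
  proof (cases "u differentiable (at t)")
    case True
    then have "((\<lambda>t. - u t) has_vector_derivative - vd u t) (at t)"
      by (intro derivative_intros) (simp add: vector_derivative_works)
    then have "vd (\<lambda>t. - u t) t = - vd u t" by (rule vector_derivative_at)
    then show ?thesis by simp
  next
    case False
    have "\<not> (u has_vector_derivative d) (at t)" for d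
      using False differentiableI_vector by blast
    moreover from this have "\<not> ((\<lambda>t. - u t) has_vector_derivative d) (at t)" for d
      using has_vector_derivative_minus[of "\<lambda>t. - u t" d "at t"] by auto
    ultimately show ?thesis unfolding vector_derivative_def by simp
  qed
  have "H2_inner (\<lambda>t. - u t) (\<lambda>t. - u t) = H2_inner u u"
    unfolding H2_inner_def d2 vd inner_minus_left inner_minus_right minus_minus by (rule refl)
  then show ?thesis by (simp only: H2_norm_def)
qed

lemma H2_dist_commute: "H2_dist u v = H2_dist v u"
  using H2_norm_minus[of "\<lambda>t. u t - v t"] by (simp add: H2_dist_def)

lemma H2_dist_nonneg: "0 \<le> H2_dist u v"
  by (simp add: H2_dist_def H2_norm_nonneg)

lemma H2_dist_triangle:
  "\<lbrakk>u \<in> H2; v \<in> H2; w \<in> H2\<rbrakk> \<Longrightarrow> H2_dist u w \<le> H2_dist u v + H2_dist v w"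
  using H2_norm_triangle[OF H2_diff H2_diff, of u v v w] by (simp add: H2_dist_def)

text \<open>The elements of \<open>H2\<close> are functions and not classes, so equality is required
  at every point; the sup bound delivers it, with every positive \<open>M\<close>.\<close>

lemma H2_dist_eq_0_iff:
  assumes u: "u \<in> H2" and v: "v \<in> H2"
  shows "H2_dist u v = 0 \<longleftrightarrow> u = v"
proof
  assume 0: "H2_dist u v = 0"
  show "u = v"
  proof
    fix t
    have "norm (u t - v t) \<le> 0"
    proof (rule field_le_epsilon)
      fix e :: real assume "e > 0"
      then show "norm (u t - v t) \<le> 0 + e"
        using H2_sup_bound(1)[OF H2_diff[OF u v], of "e / 5" t] 0 by (simp add: H2_dist_def)
    qed
    then show "u t = v t" by simp
  qed
next
  assume "u = v"
  moreover have "has_second_deriv (\<lambda>_. 0) (\<lambda>_. 0)"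
    by (simp add: has_second_deriv_def set_integrable_def)
  ultimately have "(H2_dist u v)\<^sup>2 = 0"
    unfolding H2_dist_def by (simp add: H2_norm_sq)
  then show "H2_dist u v = 0" by simp
qed

lemma Metric_space_pair:
  "Metric_space ({0<..} \<times> H2) (\<lambda>(l::real, u) (m, v). \<bar>l - m\<bar> + H2_dist u v)"
proof
  fix p q r :: "real \<times> (real \<Rightarrow> real^3)"
  obtain l u m v n w where eq: "p = (l, u)" "q = (m, v)" "r = (n, w)" by (metis surj_pair)
  show "0 \<le> (\<lambda>(l, u) (m, v). \<bar>l - m\<bar> + H2_dist u v) p q" 
    by (simp add: eq H2_dist_nonneg)
  show "(\<lambda>(l, u) (m, v). \<bar>l - m\<bar> + H2_dist u v) p q = (\<lambda>(l, u) (m, v). \<bar>l - m\<bar> + H2_dist u v) q p"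
    by (simp add: eq H2_dist_commute[of u v] abs_minus_commute[of l m])
  assume p: "p \<in> {0<..} \<times> H2" and q: "q \<in> {0<..} \<times> H2"
  show "((\<lambda>(l, u) (m, v). \<bar>l - m\<bar> + H2_dist u v) p q = 0) = (p = q)"
    using p q H2_dist_eq_0_iff[of u v] H2_dist_nonneg[of u v]
    by (simp add: eq add_nonneg_eq_0_iff) 
  assume r: "r \<in> {0<..} \<times> H2"
  have "\<bar>l - n\<bar> \<le> \<bar>l - m\<bar> + \<bar>m - n\<bar>" by linarith
  moreover have "H2_dist u w \<le> H2_dist u v + H2_dist v w"
    using p q r by (intro H2_dist_triangle) (auto simp: eq)
  ultimately show "(\<lambda>(l, u) (m, v). \<bar>l - m\<bar> + H2_dist u v) p r
    \<le> (\<lambda>(l, u) (m, v). \<bar>l - m\<bar> + H2_dist u v) p q + (\<lambda>(l, u) (m, v). \<bar>l - m\<bar> + H2_dist u v) q r"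
    by (simp add: eq)
qed

section \<open>Classical regularity and a differential inequality\<close>

lemma norm_cross3_le: "norm (cross3 a b) \<le> norm a * norm b"
proof (rule power2_le_imp_le)
  show "(norm (cross3 a b))\<^sup>2 \<le> (norm a * norm b)\<^sup>2"
    by (simp add: norm_cross power_mult_distrib)
qed simp

lemma bounded_linear_cross3: "bounded_linear (cross3 a)" "bounded_linear (\<lambda>a. cross3 a b)"
  using bilinear_cross by (auto simp: bilinear_def linear_conv_bounded_linear)

text \<open>
  Here y is only absolutely continuous, with weak derivative w. With W the integral of |w| and
  K a bound of |y|, the increment of $x \times y$ over [r, s] differs from the integral of F by at
  most 2 K (s - r) (W s - W r), which is o(s - r).
\<close>

lemma has_vector_derivative_cross3_weak:
  fixes x y w F :: "real \<Rightarrow> real^3"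
  assumes x: "\<And>t. t \<in> {0..T} \<Longrightarrow> (x has_vector_derivative y t) (at t within {0..T})"
    and y: "continuous_on {0..T} y" and F: "continuous_on {0..T} F"
    and w: "w absolutely_integrable_on {0..T}"
    and yw: "\<And>a b. 0 \<le> a \<Longrightarrow> a \<le> b \<Longrightarrow> b \<le> T \<Longrightarrow> (w has_integral (y b - y a)) {a..b}"
    and N: "negligible N" "\<And>t. t \<in> {0..T} - N \<Longrightarrow> cross3 (x t) (w t) = F t"
    and t: "t \<in> {0..T}"
  shows "((\<lambda>t. cross3 (x t) (y t)) has_vector_derivative F t) (at t within {0..T})"
proof -
  obtain K where K: "K > 0" "\<And>t. t \<in> {0..T} \<Longrightarrow> norm (y t) \<le> K"
    using compact_imp_bounded[OF compact_continuous_image[OF y]] by (auto simp: bounded_pos)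
  define H where "H = (\<lambda>t. cross3 (x t) (y t))"
  define W where "W = (\<lambda>s. integral {0..s} (\<lambda>t. norm (w t)))"
  define D where "D = (\<lambda>s. H s - integral {0..s} F)"
  have nw: "(\<lambda>t. norm (w t)) integrable_on {0..T}"
    using w by (auto simp: absolutely_integrable_on_def)
  have Wdiff: "W s - W r = integral {r..s} (\<lambda>t. norm (w t))" if "0 \<le> r" "r \<le> s" "s \<le> T" for r s
    unfolding W_def using Henstock_Kurzweil_Integration.integral_combine[of 0 r s "\<lambda>t. norm (w t)"] that
      integrable_on_subinterval[OF nw, of 0 s] by auto
  have Wmono: "W r \<le> W s" if "0 \<le> r" "r \<le> s" "s \<le> T" for r s
    using Wdiff[OF that] integrable_on_subinterval[OF nw, of r s] that
      integral_nonneg[of "\<lambda>t. norm (w t)" "{r..s}"] by auto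
  have Dle: "norm (D s - D r) \<le> 2 * K * (s - r) * (W s - W r)" if r: "0 \<le> r" "r \<le> s" "s \<le> T" for r s
  proof -
    have sub: "{r..s} \<subseteq> {0..T}" using r by auto
    have yx: "(y has_integral (x b - x a)) {a..b}" if "0 \<le> a" "a \<le> b" "b \<le> T" for a b
      using that by (intro fundamental_theorem_of_calculus) 
        (auto intro: has_vector_derivative_within_subset[OF x])
    \<comment> \<open>The integrand of the increment of \<open>D\<close>, after the product
      increment is split at \<open>x r\<close> and \<open>y s\<close>. Freezing these two values
      leaves only integrals of \<open>w\<close> and of \<open>y\<close>, which are known.\<close>
    define g where "g = (\<lambda>\<tau>. cross3 (x r) (w \<tau>) + cross3 (y \<tau>) (y s) - F \<tau>)"
    \<comment> \<open>Off \<open>N\<close> the function \<open>F\<close> equals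
      \<open>x \<times> w\<close>; on \<open>N\<close> it need not, so the integrand is set to 0
      there and the bound by \<open>h\<close> holds at every point.\<close>
    define g' where "g' = (\<lambda>\<tau>. if \<tau> \<in> N then 0 else g \<tau>)"
    define h where "h = (\<lambda>\<tau>. (K * (s - r)) * norm (w \<tau>) + K * (W s - W r))"
    have i1: "((\<lambda>\<tau>. cross3 (x r) (w \<tau>)) has_integral cross3 (x r) (y s - y r)) {r..s}"
      using has_integral_linear[OF yw bounded_linear_cross3(1)] r by (simp add: o_def)
    have i2: "((\<lambda>\<tau>. cross3 (y \<tau>) (y s)) has_integral cross3 (x s - x r) (y s)) {r..s}"
      using has_integral_linear[OF yx bounded_linear_cross3(2)] r by (simp add: o_def)
    have iF: "(F has_integral integral {r..s} F) {r..s}"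
      using continuous_on_subset[OF F sub] by (simp add: integrable_continuous_real integrable_integral)
    have "integral {0..s} F - integral {0..r} F = integral {r..s} F"
      using Henstock_Kurzweil_Integration.integral_combine[of 0 r s F] r
        integrable_continuous_real[OF continuous_on_subset[OF F, of "{0..s}"]] by (auto simp: algebra_simps)
    note IF = this
    have eq: "D s - D r = cross3 (x r) (y s - y r) + cross3 (x s - x r) (y s) - integral {r..s} F"
      by (simp add: D_def H_def Cross3.left_diff_distrib Cross3.right_diff_distrib flip: IF)
    have "(g has_integral (D s - D r)) {r..s}"
      unfolding g_def eq by (intro has_integral_diff has_integral_add i1 i2 iF)
    then have g': "(g' has_integral (D s - D r)) {r..s}"
      by (rule has_integral_spike[OF N(1), rotated]) (auto simp: g'_def)
    have nwi: "(\<lambda>t. norm (w t)) integrable_on {a..b}" if "0 \<le> a" "b \<le> T" for a b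
      by (rule integrable_on_subinterval[OF nw]) (use that in auto)
    have h: "(h has_integral (K * (s - r) * (W s - W r) + K * (W s - W r) * (s - r))) {r..s}"
    proof -
      have "((\<lambda>t. norm (w t)) has_integral (W s - W r)) {r..s}"
        using nwi[of r s] r by (simp add: Wdiff integrable_integral)
      moreover have "((\<lambda>t. K * (W s - W r)) has_integral (K * (W s - W r) * (s - r))) {r..s}"
        using has_integral_const_real[of "K * (W s - W r)" r s] r by (simp add: mult.commute)
      ultimately show ?thesis
        unfolding h_def by (intro has_integral_add has_integral_mult_right)
    qed
    have le: "norm (g' \<tau>) \<le> h \<tau>" if \<tau>: "\<tau> \<in> {r..s}" for \<tau>
    proof (cases "\<tau> \<in> N")
      case True
      show ?thesis using True Wmono[OF r] K(1) r by (auto simp: g'_def h_def)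
    next
      case False
      have xd: "norm (x r - x \<tau>) \<le> K * (s - r)"
      proof -
        have "norm (x \<tau> - x r) \<le> K * (\<tau> - r)"
          using has_integral_bound_real[OF _ _ yx[of r \<tau>], of K "{}"] K r \<tau> by auto
        also have "\<dots> \<le> K * (s - r)" using K(1) \<tau> by simp
        finally show ?thesis by (simp add: norm_minus_commute)
      qed
      have yd: "norm (y \<tau> - y s) \<le> W s - W r"
      proof -
        have "norm (y s - y \<tau>) = norm (integral {\<tau>..s} w)"
          using yw[of \<tau> s] r \<tau> by (simp add: integral_unique)
        also have "\<dots> \<le> integral {\<tau>..s} (\<lambda>t. norm (w t))"
          using yw[of \<tau> s] r \<tau> nwi[of \<tau> s] by (intro integral_norm_bound_integral) auto
        also have "\<dots> \<le> integral {r..s} (\<lambda>t. norm (w t))"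
          using r \<tau> nwi by (intro integral_subset_le) auto
        finally show ?thesis using r by (simp add: norm_minus_commute Wdiff)
      qed
      have "F \<tau> = cross3 (x \<tau>) (w \<tau>)" using N(2)[of \<tau>] False \<tau> r by auto
      \<comment> \<open>Subtracting \<open>F\<close> as \<open>x \<times> w\<close> and inserting
        the vanishing product of \<open>y s\<close> with itself leaves only increments of
        \<open>x\<close> and of \<open>y\<close>.\<close>
      then have "g' \<tau> = cross3 (x r - x \<tau>) (w \<tau>) + cross3 (y \<tau> - y s) (y s)"
        using False by (simp add: g'_def g_def Cross3.left_diff_distrib)
      also have "norm \<dots> \<le> norm (x r - x \<tau>) * norm (w \<tau>) + norm (y \<tau> - y s) * norm (y s)"
        by (intro norm_triangle_mono norm_cross3_le)
      also have "\<dots> \<le> (K * (s - r)) * norm (w \<tau>) + (W s - W r) * K"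
        using xd yd K(2)[of s] r order_trans[OF norm_ge_zero xd] order_trans[OF norm_ge_zero yd]
        by (intro add_mono mult_mono) auto
      finally show ?thesis by (simp add: h_def mult.commute)
    qed
    have "norm (integral {r..s} g') \<le> integral {r..s} h"
      using g' h le by (intro integral_norm_bound_integral) auto
    then show ?thesis using integral_unique[OF g'] integral_unique[OF h] by (simp add: algebra_simps)
  qed
  have Wc: "continuous_on {0..T} W"
    unfolding W_def by (rule indefinite_integral_continuous_1[OF nw])
  \<comment> \<open>By \<open>Dle\<close> the difference quotient of \<open>D\<close> at
    \<open>t\<close> is at most \<open>2 * K\<close> times the increment of \<open>W\<close>, which
    tends to 0 because \<open>W\<close> is continuous.\<close>
  have "(D has_vector_derivative 0) (at t within {0..T})"
    unfolding has_vector_derivative_def has_derivative_within_alt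
  proof (intro conjI allI impI)
    fix e :: real assume "e > 0"
    then have "e / (2 * K) > 0" using K by simp
    then obtain d where d: "d > 0" "\<And>s. s \<in> {0..T} \<Longrightarrow> dist s t < d \<Longrightarrow> dist (W s) (W t) < e / (2 * K)"
      using Wc t unfolding continuous_on_iff by metis
    have "norm (D s - D t - (s - t) *\<^sub>R 0) \<le> e * norm (s - t)" if s: "s \<in> {0..T}" "norm (s - t) < d" for s
    proof -
      have "norm (D s - D t) \<le> 2 * K * \<bar>s - t\<bar> * \<bar>W s - W t\<bar>"
      proof (cases "s \<le> t")
        case True
        have "norm (D s - D t) \<le> 2 * K * (t - s) * (W t - W s)"
          using Dle[of s t] s t True by (simp add: norm_minus_commute)
        also have "\<dots> \<le> 2 * K * \<bar>s - t\<bar> * \<bar>W s - W t\<bar>" using True K(1) Wmono[of s t] s t by (intro mult_mono) auto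
        finally show ?thesis .
      next
        case False
        have "norm (D s - D t) \<le> 2 * K * (s - t) * (W s - W t)"
          using Dle[of t s] s t False by simp
        also have "\<dots> \<le> 2 * K * \<bar>s - t\<bar> * \<bar>W s - W t\<bar>" using False K(1) Wmono[of t s] s t by (intro mult_mono) auto
        finally show ?thesis .
      qed
      also have "\<dots> \<le> 2 * K * \<bar>s - t\<bar> * (e / (2 * K))"
        using d(2)[of s] s K(1) by (intro mult_left_mono) (auto simp: dist_real_def)
      also have "\<dots> = e * norm (s - t)" using K(1) by simp
      finally show ?thesis by simp
    qed
    then show "\<exists>d>0. \<forall>s\<in>{0..T}. norm (s - t) < d \<longrightarrow> norm (D s - D t - (s - t) *\<^sub>R 0) \<le> e * norm (s - t)"
      using d(1) by blast
  qed simp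
  moreover have "((\<lambda>s. integral {0..s} F) has_vector_derivative F t) (at t within {0..T})"
    by (rule integral_has_vector_derivative[OF F t])
  ultimately have "((\<lambda>s. D s + integral {0..s} F) has_vector_derivative 0 + F t) (at t within {0..T})"
    by (rule has_vector_derivative_add)
  then show ?thesis by (simp add: D_def H_def)
qed

lemma AE_lborel_imp_negligible:
  assumes "AE t in lborel. P (t::'a::euclidean_space)" shows "negligible {t. \<not> P t}"
proof -
  obtain N where "N \<in> null_sets lborel" "{t. \<not> P t} \<subseteq> N"
    using assms by (auto elim: AE_E3 simp: eventually_ae_filter)
  then show ?thesis using null_sets_completionI negligible_iff_null_sets negligible_subset by blast
qed

text \<open>The two-sided bound on the derivative works in both time directions: \<open>g\<close>
  times \<open>exp (- K t)\<close> is nonincreasing and \<open>g\<close> times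
  \<open>exp (K t)\<close> is nondecreasing. The order of \<open>s\<close> and \<open>t\<close> is
  left open because a lowest point may precede or follow a highest one.\<close>

lemma gronwall_abs:
  fixes g :: "real \<Rightarrow> real"
  assumes g: "\<And>t. (g has_real_derivative g' t) (at t)" and b: "\<And>t. \<bar>g' t\<bar> \<le> K * g t"
  shows "g s \<le> g t * exp (K * \<bar>s - t\<bar>)"
proof (cases "t \<le> s")
  case True
  have "(\<lambda>t. g t * exp (- K * t)) s \<le> (\<lambda>t. g t * exp (- K * t)) t"
  proof (rule DERIV_nonpos_imp_nonincreasing[OF True])
    fix r
    have "((\<lambda>t. g t * exp (- K * t)) has_real_derivative (g' r - K * g r) * exp (- K * r)) (at r)"
      by (auto intro!: derivative_eq_intros g simp: algebra_simps)
    moreover have "(g' r - K * g r) * exp (- K * r) \<le> 0"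
      using b[of r] by (intro mult_nonpos_nonneg) auto
    ultimately show "\<exists>y. ((\<lambda>t. g t * exp (- K * t)) has_real_derivative y) (at r) \<and> y \<le> 0" by blast
  qed
  then show ?thesis using True by (simp add: exp_diff exp_minus field_simps right_diff_distrib)
next
  case False
  then have le: "s \<le> t" by simp
  have "(\<lambda>t. g t * exp (K * t)) s \<le> (\<lambda>t. g t * exp (K * t)) t"
  proof (rule DERIV_nonneg_imp_nondecreasing[OF le])
    fix r
    have "((\<lambda>t. g t * exp (K * t)) has_real_derivative (g' r + K * g r) * exp (K * r)) (at r)"
      by (auto intro!: derivative_eq_intros g simp: algebra_simps)
    moreover have "0 \<le> (g' r + K * g r) * exp (K * r)"
      using b[of r] by (intro mult_nonneg_nonneg) auto
    ultimately show "\<exists>y. ((\<lambda>t. g t * exp (K * t)) has_real_derivative y) (at r) \<and> 0 \<le> y" by blast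
  qed
  then show ?thesis using le by (simp add: exp_diff field_simps right_diff_distrib)
qed

section \<open>Conserved quantities and the vertical polynomial\<close>

lemma vec3_eq_iff: "(v::real^3) = vector [a, b, c] \<longleftrightarrow> v $ 1 = a \<and> v $ 2 = b \<and> v $ 3 = c"
  by (simp add: vec_eq_iff forall_3)

lemma vector3_decomp:
  "(vector [a, b, c] :: real^3) = a *\<^sub>R vector [1, 0, 0] + b *\<^sub>R vector [0, 1, 0] + c *\<^sub>R vector [0, 0, 1]"
  by (simp add: vec_eq_iff forall_3)

lemma has_vector_derivative_vector3:
  assumes "(f has_real_derivative f') F" "(g has_real_derivative g') F" "(h has_real_derivative h') F"
  shows "((\<lambda>t. vector [f t, g t, h t] :: real^3) has_vector_derivative vector [f', g', h']) F"
proof -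
  have s: "((\<lambda>t. k t *\<^sub>R a) has_vector_derivative k' *\<^sub>R a) F" 
    if "(k has_real_derivative k') F" for k k' and a :: "real^3"
    using bounded_linear.has_vector_derivative[OF bounded_linear_scaleR_left[of a], of k k' F] that
    by (simp add: has_real_derivative_iff_has_vector_derivative)
  show ?thesis
    unfolding vector3_decomp[of "f _"] vector3_decomp[of f'] by (intro has_vector_derivative_add s assms)
qed

section \<open>The equatorial reference orbit\<close>

lemma x0_has_second_deriv: "has_second_deriv (x0 R) (\<lambda>t. - x0 R t)"
  and vd_x0: "vd (x0 R) t = vector [- R * sin t, R * cos t, 0]"
proof -
  have d: "(x0 R has_vector_derivative vector [- R * sin t, R * cos t, 0]) (at t)" for t
    unfolding x0_def
    by (rule has_vector_derivative_vector3) (auto intro!: derivative_eq_intros)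
  show vd: "vd (x0 R) t = vector [- R * sin t, R * cos t, 0]" for t
    using d by (rule vector_derivative_at)
  have d2: "((\<lambda>t. vd (x0 R) t) has_vector_derivative - x0 R t) (at t)" for t
  proof -
    have "- x0 R t = vector [- R * cos t, - R * sin t, 0]"
      unfolding vec3_eq_iff by (simp add: x0_def)
    moreover have "((\<lambda>t. vector [- R * sin t, R * cos t, 0] :: real^3) has_vector_derivative vector [- R * cos t, - R * sin t, 0]) (at t)"
      by (rule has_vector_derivative_vector3) (auto intro!: derivative_eq_intros)
    ultimately show ?thesis by (simp add: vd)
  qed
  have cont: "continuous_on S (\<lambda>t. - x0 R t)" for S
    unfolding x0_def vector3_decomp[of "R * cos _"] by (intro continuous_intros)
  show "has_second_deriv (x0 R) (\<lambda>t. - x0 R t)"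
    unfolding has_second_deriv_def
  proof (intro conjI allI impI)
    show "x0 R differentiable at t" for t using d differentiableI_vector by blast
    show "(\<lambda>t. - x0 R t) \<in> borel_measurable lborel"
      using borel_measurable_continuous_onI[OF cont] by simp
    show "set_integrable lborel {0..2*pi} (\<lambda>\<eta>. (norm (- x0 R \<eta>))\<^sup>2)"
      by (intro borel_integrable_atLeastAtMost' continuous_intros cont)
    fix a b :: real assume *: "0 \<le> a \<and> a \<le> b \<and> b \<le> 2*pi"
    have "((\<lambda>t. - x0 R t) has_integral (vd (x0 R) b - vd (x0 R) a)) {a..b}"
      using * d2 by (intro fundamental_theorem_of_calculus) (auto intro: has_vector_derivative_at_within)
    moreover have "set_lebesgue_integral lborel {a..b} (\<lambda>t. - x0 R t) = integral {a..b} (\<lambda>t. - x0 R t)"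
      by (intro set_borel_integral_eq_integral borel_integrable_atLeastAtMost' cont)
    ultimately show "vd (x0 R) b - vd (x0 R) a = set_lebesgue_integral lborel {a..b} (\<lambda>t. - x0 R t)"
      by (metis integral_unique)
  qed
qed

lemma x0_H2: "x0 R \<in> H2"
  using x0_has_second_deriv by (auto simp: H2_def periodic_2pi_def x0_def)

lemma orbit_H2: "u \<in> H2 \<Longrightarrow> orbit R u \<in> H2"
  using H2_add[OF x0_H2] unfolding orbit_def[abs_def] by blast

lemma vd_orbit: assumes "u \<in> H2" shows "vd (orbit R u) t = vd (x0 R) t + vd u t"
  unfolding orbit_def[abs_def]
  by (intro vector_derivative_at has_vector_derivative_add H2_has_vd x0_H2 assms)

section \<open>Geometry on the sphere and conservation laws\<close>

locale zero_set_solution =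
  fixes R l :: real and u :: "real \<Rightarrow> real^3"
  assumes R_pos: "R > 0" and mem_Z: "(l, u) \<in> Z R"
begin

abbreviation x where "x \<equiv> orbit R u"
abbreviation y where "y \<equiv> vd (orbit R u)"
abbreviation m where "m \<equiv> \<lambda>t. cross3 (x t) (y t)"

lemma l_pos: "l > 0" and u_H2: "u \<in> H2" and norm_x: "norm (x t) = R"
  using mem_Z by (auto simp: Z_def Let_def)

lemma x_H2: "x \<in> H2" by (rule orbit_H2[OF u_H2])

lemma x_deriv: "(x has_vector_derivative y t) (at t within S)"
  using H2_has_vd[OF x_H2] by (rule has_vector_derivative_at_within)

lemma x_nth_deriv: "((\<lambda>t. x t $ i) has_real_derivative y t $ i) (at t within S)"
  using bounded_linear.has_vector_derivative[OF bounded_linear_vec_nth x_deriv]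
  by (simp add: has_real_derivative_iff_has_vector_derivative)

lemma sphere: "(x t $ 1)\<^sup>2 + (x t $ 2)\<^sup>2 + (x t $ 3)\<^sup>2 = R\<^sup>2"
proof -
  have "x t \<bullet> x t = R\<^sup>2" using norm_x[of t] by (simp add: dot_square_norm)
  then show ?thesis by (simp add: inner_vec_def sum_3 power2_eq_square)
qed

lemma tangent: "x t $ 1 * y t $ 1 + x t $ 2 * y t $ 2 + x t $ 3 * y t $ 3 = 0"
proof -
  have "((\<lambda>t. (x t $ 1)\<^sup>2 + (x t $ 2)\<^sup>2 + (x t $ 3)\<^sup>2) has_real_derivative
     2 * (x t $ 1 * y t $ 1 + x t $ 2 * y t $ 2 + x t $ 3 * y t $ 3)) (at t)"
    by (auto intro!: derivative_eq_intros x_nth_deriv simp: algebra_simps)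
  moreover have "((\<lambda>t. (x t $ 1)\<^sup>2 + (x t $ 2)\<^sup>2 + (x t $ 3)\<^sup>2) has_real_derivative 0) (at t)"
    unfolding sphere by simp
  ultimately show ?thesis using DERIV_unique by fastforce
qed

lemma x_periodic: "x (t + 2*pi) = x t" and y_periodic: "y (t + 2*pi) = y t"
  using H2_periodic[OF x_H2] H2_vd_periodic[OF x_H2] by auto

lemma y_continuous: "continuous_on {0..2*pi} y" and x_continuous: "continuous_on S x"
  using H2_vd_continuous[OF x_H2] H2_continuous[OF x_H2] by auto

text \<open>Formally the derivative is \<open>x' \<times> x' + x \<times> x''\<close>, and the first
  product vanishes. It is taken within one closed period because \<open>d2\<close> is determined
  only there; at the two ends it is one-sided.\<close>

lemma m_deriv:
  assumes t: "t \<in> {0..2*pi}"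
  shows "(m has_vector_derivative l *\<^sub>R cross3 e_vert (x t) - l *\<^sub>R y t) (at t within {0..2*pi})"
proof -
  let ?w = "d2 x"
  have w: "has_second_deriv x ?w" by (rule H2_d2[OF x_H2])
  let ?P = "\<lambda>t. t \<in> {0..2*pi} \<longrightarrow> cross3 (x t) (?w t) - l *\<^sub>R cross3 e_vert (x t) + l *\<^sub>R y t = 0"
  have "AE t in lborel. ?P t" using mem_Z by (simp add: Z_def Let_def)
  then have N: "negligible {t. \<not> ?P t}" by (rule AE_lborel_imp_negligible)
  show ?thesis
  proof (rule has_vector_derivative_cross3_weak[OF _ _ _ _ _ N _ t, where w = ?w])
    show "(x has_vector_derivative y t) (at t within {0..2*pi})" for t by (rule x_deriv)
    show "continuous_on {0..2*pi} y" by (rule y_continuous)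
    show "continuous_on {0..2*pi} (\<lambda>t. l *\<^sub>R cross3 e_vert (x t) - l *\<^sub>R y t)"
      by (intro continuous_intros continuous_on_cross x_continuous y_continuous)
    show "?w absolutely_integrable_on {0..2*pi}"
      using has_second_deriv_integrable[OF w] integrable_completion[OF borel_measurable_integrable]
      unfolding set_integrable_def by blast
    show "(?w has_integral (y b - y a)) {a..b}" if "0 \<le> a" "a \<le> b" "b \<le> 2*pi" for a b
    proof -
      have "set_integrable lborel {a..b} ?w" using that by (intro has_second_deriv_integrable_sub[OF w]) auto
      then have "(?w has_integral set_lebesgue_integral lborel {a..b} ?w) {a..b}"
        using set_borel_integral_eq_integral integrable_integral by metis
      then show ?thesis using w that by (auto simp: has_second_deriv_def)
    qed
    show "cross3 (x t) (?w t) = l *\<^sub>R cross3 e_vert (x t) - l *\<^sub>R y t" if "t \<in> {0..2*pi} - {t. \<not> ?P t}" for t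
      using that by (auto simp: algebra_simps)
  qed
qed

lemma m_nth_deriv:
  assumes "t \<in> {0..2*pi}"
  shows "((\<lambda>t. m t $ i) has_real_derivative l * cross3 e_vert (x t) $ i - l * y t $ i) (at t within {0..2*pi})"
  using bounded_linear.has_vector_derivative[OF bounded_linear_vec_nth m_deriv[OF assms]]
  by (simp add: has_real_derivative_iff_has_vector_derivative)

lemma m_nth: "m t $ 1 = x t $ 2 * y t $ 3 - x t $ 3 * y t $ 2" 
  "m t $ 2 = x t $ 3 * y t $ 1 - x t $ 1 * y t $ 3"
  "m t $ 3 = x t $ 1 * y t $ 2 - x t $ 2 * y t $ 1"
  by (simp_all add: cross3_def)

lemma e_vert_cross_nth: "cross3 e_vert (x t) $ 1 = - x t $ 2" 
  "cross3 e_vert (x t) $ 2 = x t $ 1" "cross3 e_vert (x t) $ 3 = 0"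
  by (simp_all add: cross3_def e_vert_def)

lemma norm_y_sq: "(norm (y t))\<^sup>2 = (y t $ 1)\<^sup>2 + (y t $ 2)\<^sup>2 + (y t $ 3)\<^sup>2"
  by (simp add: power2_norm_eq_inner inner_vec_def sum_3) (simp add: power2_eq_square)

text \<open>Lagrange's identity for the cross product; its inner product term vanishes because the
  velocity is tangent to the sphere.\<close>

lemma norm_m_sq: "(m t $ 1)\<^sup>2 + (m t $ 2)\<^sup>2 + (m t $ 3)\<^sup>2 = R\<^sup>2 * (norm (y t))\<^sup>2"
proof -
  have "(m t $ 1)\<^sup>2 + (m t $ 2)\<^sup>2 + (m t $ 3)\<^sup>2 = ((x t $ 1)\<^sup>2 + (x t $ 2)\<^sup>2 + (x t $ 3)\<^sup>2) * ((y t $ 1)\<^sup>2 + (y t $ 2)\<^sup>2 + (y t $ 3)\<^sup>2)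
      - (x t $ 1 * y t $ 1 + x t $ 2 * y t $ 2 + x t $ 3 * y t $ 3)\<^sup>2"
    unfolding m_nth by (simp add: power2_eq_square algebra_simps)
  then show ?thesis by (simp add: sphere tangent norm_y_sq)
qed

text \<open>One-sided derivatives at the ends of a closed period are enough, since periodicity
  carries the constant value to all other angles.\<close>

lemma constant_if_deriv_zero:
  assumes p: "\<And>t. f (t + 2*pi) = f t"
    and d: "\<And>t. t \<in> {0..2*pi} \<Longrightarrow> (f has_real_derivative 0) (at t within {0..2*pi})"
  shows "f t = f 0"
proof -
  obtain n :: int where n: "t + 2*pi * of_int n \<in> {0..2*pi}" using shift_into_period by blast
  have "\<exists>c. \<forall>t\<in>{0..2*pi}. f t = c"
    by (rule has_field_derivative_zero_constant) (use d in auto)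
  then have "f (t + 2*pi * of_int n) = f 0" using n by force
  then show ?thesis using periodic_shift_int[of f t n] p by simp
qed

text \<open>The vector \<open>e_vert \<times> x\<close> is horizontal, so the third component of the
  moment changes at exactly \<open>- l\<close> times the rate of the height.\<close>

lemma C_constant: "C_at l x t = C_at l x 0"
proof (rule constant_if_deriv_zero)
  show "C_at l x (t + 2*pi) = C_at l x t" for t by (simp add: C_at_def x_periodic y_periodic)
  fix t assume t: "t \<in> {0..2*pi}"
  have "((\<lambda>t. m t $ 3 + l * x t $ 3) has_real_derivative (l * cross3 e_vert (x t) $ 3 - l * y t $ 3) + l * y t $ 3) (at t within {0..2*pi})"
    by (intro DERIV_add DERIV_cmult x_nth_deriv m_nth_deriv[OF t])
  then show "(C_at l x has_real_derivative 0) (at t within {0..2*pi})"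
    by (simp add: C_at_def[abs_def] e_vert_cross_nth)
qed

text \<open>Replaces the velocity, for which no pointwise derivative is available, by the moment,
  for which \<open>m_deriv\<close> supplies one.\<close>

lemma E_at_eq: "E_at l x t = l / (2 * R\<^sup>2) * ((m t $ 1)\<^sup>2 + (m t $ 2)\<^sup>2 + (m t $ 3)\<^sup>2) - l * m t $ 3"
  unfolding norm_m_sq E_at_def unfolding m_nth using R_pos by (simp add: field_simps)

lemma E_constant: "E_at l x t = E_at l x 0"
proof (rule constant_if_deriv_zero)
  show "E_at l x (t + 2*pi) = E_at l x t" for t by (simp add: E_at_def x_periodic y_periodic)
  fix t assume t: "t \<in> {0..2*pi}"
  let ?d = "\<lambda>i. l * cross3 e_vert (x t) $ i - l * y t $ i"
  have "((\<lambda>t. l / (2 * R\<^sup>2) * ((m t $ 1)\<^sup>2 + (m t $ 2)\<^sup>2 + (m t $ 3)\<^sup>2) - l * m t $ 3) has_real_derivative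
     l / (2 * R\<^sup>2) * (2 * (m t $ 1 * ?d 1 + m t $ 2 * ?d 2 + m t $ 3 * ?d 3)) - l * ?d 3) (at t within {0..2*pi})"
    by (rule derivative_eq_intros m_nth_deriv[OF t] refl)+ (simp add: algebra_simps)
  \<comment> \<open>The moment is orthogonal to \<open>y\<close>, and the Binet-Cauchy identity
    evaluates \<open>(x \<times> y) \<bullet> (e \<times> x)\<close> as
    \<open>x3 (x \<bullet> y) - R^2 y3\<close>, whose first term vanishes. The result cancels
    against the term \<open>- l * m t $ 3\<close> of the energy.\<close>
  moreover have "m t $ 1 * ?d 1 + m t $ 2 * ?d 2 + m t $ 3 * ?d 3 = - l * (R\<^sup>2 * y t $ 3)"
  proof -
    have "m t $ 1 * ?d 1 + m t $ 2 * ?d 2 + m t $ 3 * ?d 3 = 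
      l * (x t $ 3 * (x t $ 1 * y t $ 1 + x t $ 2 * y t $ 2 + x t $ 3 * y t $ 3) 
        - ((x t $ 1)\<^sup>2 + (x t $ 2)\<^sup>2 + (x t $ 3)\<^sup>2) * y t $ 3)"
      unfolding e_vert_cross_nth m_nth by (simp add: power2_eq_square algebra_simps)
    then show ?thesis by (simp add: sphere tangent)
  qed
  then have "l / (2 * R\<^sup>2) * (2 * (m t $ 1 * ?d 1 + m t $ 2 * ?d 2 + m t $ 3 * ?d 3)) - l * ?d 3 = 0"
    using R_pos by (simp add: e_vert_cross_nth)
  ultimately show "(E_at l x has_real_derivative 0) (at t within {0..2*pi})"
    unfolding E_at_eq[abs_def] by (simp only:)
qed

section \<open>The vertical polynomial and its roots\<close>

text \<open>The geometric form of the polynomial. At a height \<open>s\<close> on the orbit the long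
  factor is the squared speed and \<open>C - l s\<close> is the vertical moment; at
  \<open>s = R\<close> and \<open>s = - R\<close> only the last square survives.\<close>

lemma vert_poly_eq:
  "R\<^sup>2 * vert_poly R l u s = (R\<^sup>2 - s\<^sup>2) * (2 * E_at l x 0 / l + 2 * C_at l x 0 - 2 * l * s) - (C_at l x 0 - l * s)\<^sup>2"
proof -
  have "R\<^sup>2 * (a / R\<^sup>2 * s ^ 3 - b / (l * R\<^sup>2) * s\<^sup>2 + c / R\<^sup>2 * s + d / (l * R\<^sup>2))
      = a * s ^ 3 - b / l * s\<^sup>2 + c * s + d / l" for a b c d
    using R_pos l_pos by (simp add: field_simps)
  then have "R\<^sup>2 * vert_poly R l u s = 2 * l * s ^ 3 - (2 * E_at l x 0 + l ^ 3 + 2 * l * C_at l x 0) / l * s\<^sup>2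
    + (2 * l * C_at l x 0 - 2 * l * R\<^sup>2) * s + (2 * E_at l x 0 * R\<^sup>2 - l * (C_at l x 0)\<^sup>2 + 2 * l * C_at l x 0 * R\<^sup>2) / l"
    unfolding vert_poly_def Let_def .
  also have "\<dots> = (R\<^sup>2 - s\<^sup>2) * (2 * E_at l x 0 / l + 2 * C_at l x 0 - 2 * l * s) - (C_at l x 0 - l * s)\<^sup>2"
    using l_pos by (simp add: field_simps power2_eq_square power3_eq_cube)
  finally show ?thesis .
qed

text \<open>In the form of \<open>vert_poly_eq\<close> the right-hand side is
  \<open>(R^2 - x3^2) |x'|^2 - m3^2\<close>, up to the factor \<open>R^2\<close>. Lagrange's
  identity in the horizontal plane, with the horizontal inner product equal to
  \<open>- x3 x3'\<close> by tangency, leaves \<open>R^2 (x3')^2\<close>.\<close>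

lemma vertical_ode: "(y t $ 3)\<^sup>2 = vert_poly R l u (x t $ 3)"
proof -
  let ?C = "C_at l x t" and ?E = "E_at l x t"
  have h: "?C - l * x t $ 3 = m t $ 3" by (simp add: C_at_def)
  have "?E / l = (norm (y t))\<^sup>2 / 2 - m t $ 3"
    unfolding E_at_def m_nth using l_pos by (simp add: field_simps)
  then have n: "2 * ?E / l + 2 * ?C - 2 * l * x t $ 3 = (norm (y t))\<^sup>2" using h by simp
  have "R\<^sup>2 * vert_poly R l u (x t $ 3) = (R\<^sup>2 - (x t $ 3)\<^sup>2) * (norm (y t))\<^sup>2 - (m t $ 3)\<^sup>2"
    unfolding vert_poly_eq C_constant[of t, symmetric] E_constant[of t, symmetric] n h ..
  also have "\<dots> = R\<^sup>2 * (y t $ 3)\<^sup>2"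
  proof -
    let ?a = "x t $ 1" and ?b = "x t $ 2" and ?c = "x t $ 3" and ?p = "y t $ 1" and ?q = "y t $ 2" and ?r = "y t $ 3"
    have "R\<^sup>2 - ?c\<^sup>2 = ?a\<^sup>2 + ?b\<^sup>2" using sphere[of t] by simp
    moreover have "?a * ?p + ?b * ?q = - ?c * ?r" using tangent[of t] by simp
    then have "(?a * ?p + ?b * ?q)\<^sup>2 = ?c\<^sup>2 * ?r\<^sup>2" by (simp add: power_mult_distrib)
    moreover have "(?a\<^sup>2 + ?b\<^sup>2) * (?p\<^sup>2 + ?q\<^sup>2 + ?r\<^sup>2) - (?a * ?q - ?b * ?p)\<^sup>2 = (?a * ?p + ?b * ?q)\<^sup>2 + (?a\<^sup>2 + ?b\<^sup>2) * ?r\<^sup>2"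
      by (simp add: power2_eq_square algebra_simps)
    ultimately have "(R\<^sup>2 - ?c\<^sup>2) * (?p\<^sup>2 + ?q\<^sup>2 + ?r\<^sup>2) - (?a * ?q - ?b * ?p)\<^sup>2 = (?c\<^sup>2 + (?a\<^sup>2 + ?b\<^sup>2)) * ?r\<^sup>2"
      by (simp add: algebra_simps)
    moreover have "?c\<^sup>2 + (?a\<^sup>2 + ?b\<^sup>2) = R\<^sup>2" using sphere[of t] by simp
    ultimately show ?thesis unfolding norm_y_sq m_nth by simp
  qed
  finally show ?thesis using R_pos by simp
qed

lemma abs_x3_le: "\<bar>x t $ 3\<bar> \<le> R"
  using component_le_norm_cart[of "x t" 3] norm_x by simp

text \<open>At a pole \<open>vert_poly_eq\<close> reduces to minus the square of
  \<open>C - l s\<close>, so a root there determines \<open>C\<close>.\<close>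

lemma pole_root_imp_C:
  "vert_poly R l u R = 0 \<Longrightarrow> C_at l x t = l * R"
  "vert_poly R l u (- R) = 0 \<Longrightarrow> C_at l x t = - l * R"
  using vert_poly_eq[of R] vert_poly_eq[of "- R"] C_constant[of t] by auto

lemma root_gap_estimate:
  assumes e: "is_min_of e1 (\<lambda>t. x t $ 3)" "is_max_of e2 (\<lambda>t. x t $ 3)" and e3: "e2 \<le> e3"
    and P: "\<And>s. vert_poly R l u s = 2 * l / R\<^sup>2 * (s - e1) * (s - e2) * (s - e3)"
  shows "e3 - e1 \<le> (e3 - e2) * exp (4 * pi * sqrt (l / R))"
proof -
  obtain t1' t2' where t': "x t1' $ 3 = e1" "x t2' $ 3 = e2" using e by (auto simp: is_min_of_def is_max_of_def)
  \<comment> \<open>Both extremal times are moved into \<open>{0..2*pi}\<close>; they are then at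
    most one period apart, which bounds the exponent by \<open>K * (2*pi)\<close>.\<close>
  obtain n1 n2 :: int where n: "t1' + 2*pi * of_int n1 \<in> {0..2*pi}" "t2' + 2*pi * of_int n2 \<in> {0..2*pi}"
    using shift_into_period by metis
  define t1 t2 where "t1 = t1' + 2*pi * of_int n1" and "t2 = t2' + 2*pi * of_int n2"
  have t: "x t1 $ 3 = e1" "x t2 $ 3 = e2" "\<bar>t1 - t2\<bar> \<le> 2*pi"
    using t' n periodic_shift_int[of x, OF x_periodic] by (auto simp: t1_def t2_def)
  define K where "K = 2 * sqrt (l / R)"
  have K: "K \<ge> 0" "K\<^sup>2 = 4 * l / R" using l_pos R_pos by (auto simp: K_def power_mult_distrib)
  have "\<bar>- y s $ 3\<bar> \<le> K * (e3 - x s $ 3)" for s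
  proof (rule power2_le_imp_le)
    let ?v = "x s $ 3"
    have v: "e1 \<le> ?v" "?v \<le> e2" using e by (auto simp: is_min_of_def is_max_of_def)
    have e1: "- R \<le> e1" using abs_x3_le[of t1] t by simp
    have vR: "?v \<le> R" using abs_x3_le[of s] by simp
    have "\<bar>- y s $ 3\<bar>\<^sup>2 = 2 * l / R\<^sup>2 * ((?v - e1) * ((e2 - ?v) * (e3 - ?v)))"
    proof -
      have "k * (v - e1) * (v - e2) * (v - e3) = k * ((v - e1) * ((e2 - v) * (e3 - v)))" for k v
        by (simp add: algebra_simps)
      then show ?thesis using vertical_ode[of s] P[of ?v] by simp
    qed
    \<comment> \<open>Both \<open>e1\<close> and \<open>?v\<close> are heights on the sphere, whence
      \<open>?v - e1 \<le> 2 * R\<close>; and \<open>e2 - ?v\<close> is replaced by the larger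
      \<open>e3 - ?v\<close> to complete a square.\<close>
    also have "\<dots> \<le> 2 * l / R\<^sup>2 * ((2 * R) * ((e3 - ?v) * (e3 - ?v)))"
      using v e1 vR e3 l_pos by (intro mult_left_mono mult_mono) auto
    also have "\<dots> = (K * (e3 - ?v))\<^sup>2" 
      unfolding power_mult_distrib K using R_pos by (simp add: field_simps power2_eq_square)
    finally show "\<bar>- y s $ 3\<bar>\<^sup>2 \<le> (K * (e3 - ?v))\<^sup>2" .
    show "0 \<le> K * (e3 - ?v)" using K v e3 by simp
  qed
  then have "e3 - x t1 $ 3 \<le> (e3 - x t2 $ 3) * exp (K * \<bar>t1 - t2\<bar>)"
    by (intro gronwall_abs[where g = "\<lambda>s. e3 - x s $ 3" and g' = "\<lambda>s. - y s $ 3"])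
       (auto intro!: derivative_eq_intros x_nth_deriv)
  also have "\<dots> \<le> (e3 - e2) * exp (K * (2*pi))"
    unfolding t using t(3) K e3 by (intro mult_left_mono) (auto intro: mult_left_mono)
  finally show ?thesis by (simp add: t K_def mult.commute mult.left_commute)
qed

end

section \<open>The horizontal degree and constant-latitude solutions\<close>

lemma constant_of_vector_derivative_zero:
  fixes f :: "real \<Rightarrow> 'a::real_normed_vector"
  assumes "convex S" "\<And>t. t \<in> S \<Longrightarrow> (f has_vector_derivative 0) (at t within S)" "s \<in> S" "t \<in> S"
  shows "f s = f t"
proof -
  have "\<exists>c. \<forall>t\<in>S. f t = c"
    using assms(1,2) by (intro has_derivative_zero_constant) (auto simp: has_vector_derivative_def)
  then show ?thesis using assms by auto
qed

text \<open>In the complex plane the angular speed is the imaginary part of \<open>z' / z\<close>,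
  and uniform rotation is multiplication by an exponential.\<close>

definition horizontal :: "real^3 \<Rightarrow> complex" where
  "horizontal v = Complex (v $ 1) (v $ 2)"

lemma bounded_linear_horizontal: "bounded_linear horizontal"
  unfolding linear_conv_bounded_linear[symmetric]
  by (rule linearI) (simp_all add: horizontal_def complex_eq_iff)

abbreviation angular_speed :: "real \<Rightarrow> (real \<Rightarrow> real^3) \<Rightarrow> real \<Rightarrow> real" where
  "angular_speed R u t \<equiv> (orbit R u t $ 1 * vd (orbit R u) t $ 2 - orbit R u t $ 2 * vd (orbit R u) t $ 1) /
     ((orbit R u t $ 1)\<^sup>2 + (orbit R u t $ 2)\<^sup>2)"

lemma horizontal_degree_eq: "horizontal_degree R u = 1 / (2*pi) * integral {0..2*pi} (angular_speed R u)"
  by (simp add: horizontal_degree_def Let_def)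

lemma angular_speed_continuous:
  assumes "u \<in> H2" "\<And>t. (orbit R u t $ 1)\<^sup>2 + (orbit R u t $ 2)\<^sup>2 \<noteq> 0"
  shows "continuous_on {0..2*pi} (angular_speed R u)"
  by (intro continuous_on_divide continuous_on_diff continuous_on_mult continuous_on_add continuous_on_power
      continuous_on_component H2_continuous H2_vd_continuous orbit_H2 ballI assms)

text \<open>With \<open>F\<close> the integral of \<open>z' / z\<close>, the product
  \<open>z * exp (- F)\<close> is constant. Since \<open>z\<close> returns to its nonzero initial
  value, \<open>exp (F (2*pi)) = 1\<close>, and the imaginary part of \<open>F (2*pi)\<close> is an
  integer multiple of \<open>2 pi\<close>.\<close>

lemma horizontal_degree_Ints:
  assumes u: "u \<in> H2" and nz: "\<And>t. (orbit R u t $ 1)\<^sup>2 + (orbit R u t $ 2)\<^sup>2 \<noteq> 0"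
  shows "horizontal_degree R u \<in> \<int>"
proof -
  let ?x = "orbit R u"
  have x: "?x \<in> H2" by (rule orbit_H2[OF u])
  define z where "z = (\<lambda>t. horizontal (?x t))"
  define z' where "z' = (\<lambda>t. horizontal (vd ?x t))"
  define q where "q = (\<lambda>t. z' t / z t)"
  define F where "F = (\<lambda>t. integral {0..t} q)"
  have z0: "z t \<noteq> 0" for t using nz[of t] by (auto simp: z_def horizontal_def complex_eq_iff)
  have dz: "(z has_vector_derivative z' t) (at t within S)" for t S
    unfolding z_def z'_def
    by (rule bounded_linear.has_vector_derivative[OF bounded_linear_horizontal])
       (rule has_vector_derivative_at_within[OF H2_has_vd[OF x]])
  have cz': "continuous_on {0..2*pi} z'"
    unfolding z'_def by (rule bounded_linear.continuous_on[OF bounded_linear_horizontal H2_vd_continuous[OF x]])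
  have cz: "continuous_on {0..2*pi} z"
    unfolding z_def by (rule bounded_linear.continuous_on[OF bounded_linear_horizontal H2_continuous[OF x]])
  have cq: "continuous_on {0..2*pi} q"
    unfolding q_def by (intro continuous_on_divide cz cz') (use z0 in auto)
  have dF: "(F has_vector_derivative q t) (at t within {0..2*pi})" if "t \<in> {0..2*pi}" for t
    unfolding F_def by (rule integral_has_vector_derivative[OF cq that])
  have "z (2*pi) * exp (- F (2*pi)) = z 0 * exp (- F 0)"
  proof (rule constant_of_vector_derivative_zero[of "{0..2*pi}"])
    fix t :: real assume t: "t \<in> {0..2*pi}"
    have "((\<lambda>s. exp (- s)) has_field_derivative - exp (- F t)) (at (F t) within F ` {0..2*pi})"
      by (auto intro!: derivative_eq_intros)
    from field_vector_diff_chain_within[OF dF[OF t] this]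
    have e: "((\<lambda>t. exp (- F t)) has_vector_derivative q t * - exp (- F t)) (at t within {0..2*pi})"
      by (simp add: o_def)
    have "((\<lambda>t. z t * exp (- F t)) has_vector_derivative z t * (q t * - exp (- F t)) + z' t * exp (- F t)) (at t within {0..2*pi})"
      by (rule has_vector_derivative_mult[OF dz e])
    moreover have "z t * (q t * - exp (- F t)) + z' t * exp (- F t) = 0"
      using z0[of t] by (simp add: q_def)
    ultimately show "((\<lambda>t. z t * exp (- F t)) has_vector_derivative 0) (at t within {0..2*pi})" by simp
  qed (use pi_ge_zero in auto)
  moreover have "z (2*pi) = z 0" using H2_periodic[OF x, of 0] by (simp add: z_def)
  ultimately have "exp (F (2*pi)) = 1"
    using z0[of 0] by (simp add: F_def exp_minus inverse_eq_1_iff)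
  then obtain n :: int where n: "Im (F (2*pi)) = of_int (2 * n) * pi" by (auto simp: exp_eq_1)
  have "(q has_integral F (2*pi)) {0..2*pi}"
    unfolding F_def by (intro integrable_integral integrable_continuous_real cq)
  then have "((\<lambda>t. Im (q t)) has_integral Im (F (2*pi))) {0..2*pi}"
    using has_integral_linear[OF _ bounded_linear_Im, of q "F (2*pi)" "{0..2*pi}"] by (simp add: o_def)
  moreover have "Im (q t) = angular_speed R u t" for t
    unfolding q_def z_def z'_def horizontal_def Im_divide by (simp add: mult.commute)
  ultimately have "integral {0..2*pi} (angular_speed R u) = of_int (2 * n) * pi"
    using n by (simp add: integral_unique)
  then have "horizontal_degree R u = of_int n" unfolding horizontal_degree_eq by simp
  then show ?thesis by simp
qed

text \<open>The squared horizontal distance of the limit has a positive minimum on the compact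
  period, which makes the quotients converge uniformly. The hypotheses ask for uniform convergence
  rather than H2 convergence, which suits phase translates too.\<close>

lemma horizontal_degree_tendsto:
  assumes us: "\<And>n. us n \<in> H2" "\<And>n t. (orbit R (us n) t $ 1)\<^sup>2 + (orbit R (us n) t $ 2)\<^sup>2 \<noteq> 0"
    and u: "u \<in> H2" "\<And>t. (orbit R u t $ 1)\<^sup>2 + (orbit R u t $ 2)\<^sup>2 \<noteq> 0"
    and l0: "uniform_limit {0..2*pi} us u sequentially"
    and l1: "uniform_limit {0..2*pi} (\<lambda>n. vd (us n)) (vd u) sequentially"
  shows "(\<lambda>n. horizontal_degree R (us n)) \<longlonglongrightarrow> horizontal_degree R u"
proof -
  let ?I = "{0..2*pi}"
  have x0: "uniform_limit ?I (\<lambda>n t. orbit R (us n) t) (\<lambda>t. orbit R u t) sequentially"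
    unfolding orbit_def by (intro uniform_limit_intros l0)
  have x1: "uniform_limit ?I (\<lambda>n t. vd (orbit R (us n)) t) (\<lambda>t. vd (orbit R u) t) sequentially"
    unfolding vd_orbit[OF us(1)] vd_orbit[OF u(1)] by (intro uniform_limit_intros l1)
  have c: "uniform_limit ?I (\<lambda>n t. orbit R (us n) t $ i) (\<lambda>t. orbit R u t $ i) sequentially"
    "uniform_limit ?I (\<lambda>n t. vd (orbit R (us n)) t $ i) (\<lambda>t. vd (orbit R u) t $ i) sequentially" for i
    using bounded_linear.uniform_limit[OF bounded_linear_vec_nth x0] bounded_linear.uniform_limit[OF bounded_linear_vec_nth x1] by auto
  have co: "continuous_on ?I (\<lambda>t. orbit R u t $ i)" "continuous_on ?I (\<lambda>t. vd (orbit R u) t $ i)" for i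
    by (intro continuous_intros H2_continuous H2_vd_continuous orbit_H2 u)+
  have bd: "bounded (f ` ?I)" if "continuous_on ?I f" for f :: "real \<Rightarrow> real"
    using that by (intro compact_imp_bounded compact_continuous_image) auto
  have "continuous_on ?I (\<lambda>t. (orbit R u t $ 1)\<^sup>2 + (orbit R u t $ 2)\<^sup>2)"
    by (intro continuous_intros co)
  then obtain s where s: "s \<in> ?I" "\<And>t. t \<in> ?I \<Longrightarrow> (orbit R u s $ 1)\<^sup>2 + (orbit R u s $ 2)\<^sup>2 \<le> (orbit R u t $ 1)\<^sup>2 + (orbit R u t $ 2)\<^sup>2"
    using continuous_attains_inf[of ?I "\<lambda>t. (orbit R u t $ 1)\<^sup>2 + (orbit R u t $ 2)\<^sup>2"] by auto
  have pos: "0 < (orbit R u s $ 1)\<^sup>2 + (orbit R u s $ 2)\<^sup>2"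
    using u(2)[of s] by (simp add: less_le)
  have num: "uniform_limit ?I (\<lambda>n t. orbit R (us n) t $ 1 * vd (orbit R (us n)) t $ 2 - orbit R (us n) t $ 2 * vd (orbit R (us n)) t $ 1)
      (\<lambda>t. orbit R u t $ 1 * vd (orbit R u) t $ 2 - orbit R u t $ 2 * vd (orbit R u) t $ 1) sequentially"
    by (intro uniform_limit_minus uniform_lim_mult c bd co)
  have den: "uniform_limit ?I (\<lambda>n t. (orbit R (us n) t $ 1)\<^sup>2 + (orbit R (us n) t $ 2)\<^sup>2)
      (\<lambda>t. (orbit R u t $ 1)\<^sup>2 + (orbit R u t $ 2)\<^sup>2) sequentially"
    unfolding power2_eq_square by (intro uniform_limit_add uniform_lim_mult c bd co)
  have "continuous_on ?I (\<lambda>t. orbit R u t $ 1 * vd (orbit R u) t $ 2 - orbit R u t $ 2 * vd (orbit R u) t $ 1)"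
    by (intro continuous_on_diff continuous_on_mult co)
  then have "uniform_limit ?I (\<lambda>n. angular_speed R (us n)) (angular_speed R u) sequentially"
    using s(2) pos by (intro uniform_lim_divide[OF num den bd, where b = "(orbit R u s $ 1)\<^sup>2 + (orbit R u s $ 2)\<^sup>2"]) auto
  note lim = this
  obtain I J where IJ: "\<And>n. (angular_speed R (us n) has_integral I n) ?I" "(angular_speed R u has_integral J) ?I" "I \<longlonglongrightarrow> J"
    by (rule uniform_limit_integral[OF lim angular_speed_continuous[OF us] sequentially_bot]) (rule that)
  show ?thesis unfolding horizontal_degree_eq
    unfolding integral_unique[OF IJ(1)] integral_unique[OF IJ(2)] by (intro tendsto_mult tendsto_const IJ(3))
qed

lemma H2_dist_imp_sup_le:
  assumes us: "\<And>n. us n \<in> H2" and u: "u \<in> H2" and lim: "(\<lambda>n. H2_dist (us n) u) \<longlonglongrightarrow> 0" and e: "e > 0"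
  shows "eventually (\<lambda>n. \<forall>t. norm (us n t - u t) \<le> e \<and> norm (vd (us n) t - vd u t) \<le> e) sequentially"
proof -
  have "eventually (\<lambda>n. H2_dist (us n) u < e / 5) sequentially"
    by (rule order_tendstoD[OF lim]) (use e in simp)
  then show ?thesis
  proof eventually_elim
    case (elim n)
    have "vd (\<lambda>t. us n t - u t) t = vd (us n) t - vd u t" for t
      by (intro vector_derivative_at has_vector_derivative_diff H2_has_vd us u)
    then show ?case
      using H2_sup_bound[OF H2_diff[OF us u], of n "e / 5"] elim by (auto simp: H2_dist_def)
  qed
qed

lemma H2_dist_imp_uniform_limit:
  assumes us: "\<And>n. us n \<in> H2" and u: "u \<in> H2" and lim: "(\<lambda>n. H2_dist (us n) u) \<longlonglongrightarrow> 0"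
  shows "uniform_limit S us u sequentially" "uniform_limit S (\<lambda>n. vd (us n)) (vd u) sequentially"
proof -
  have *: "eventually (\<lambda>n. \<forall>t. norm (us n t - u t) < e \<and> norm (vd (us n) t - vd u t) < e) sequentially" if "e > 0" for e
  proof -
    have "e / 2 < e" using that by simp
    have "eventually (\<lambda>n. \<forall>t. norm (us n t - u t) \<le> e / 2 \<and> norm (vd (us n) t - vd u t) \<le> e / 2) sequentially"
      by (rule H2_dist_imp_sup_le[OF us u lim]) (use that in simp)
    then show ?thesis
      by (rule eventually_mono) (blast intro: le_less_trans[OF _ \<open>e / 2 < e\<close>])
  qed
  show "uniform_limit S us u sequentially" "uniform_limit S (\<lambda>n. vd (us n)) (vd u) sequentially"
    by (auto intro!: uniform_limitI simp: dist_norm elim!: eventually_mono[OF *])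
qed

context zero_set_solution
begin

lemma horizontal_nonzero: "\<bar>x t $ 3\<bar> < R \<Longrightarrow> (x t $ 1)\<^sup>2 + (x t $ 2)\<^sup>2 \<noteq> 0"
  using sphere[of t] power2_strict_mono[of "x t $ 3" R] by auto

text \<open>At constant height the vertical moment is constant, so the horizontal motion is a
  rotation of constant angular velocity, which periodicity makes an integer. The horizontal
  components of the moment equation then tie it to the latitude.\<close>

lemma constant_latitude:
  assumes lat: "\<And>t. x t $ 3 = u0" and u0: "\<bar>u0\<bar> < R"
  obtains p :: int and \<phi> where "p \<noteq> 0" "u0 = l * (of_int p - 1) / (of_int p)\<^sup>2"
    "\<And>t. x t = vector [sqrt (R\<^sup>2 - u0\<^sup>2) * cos (of_int p * t + \<phi>), sqrt (R\<^sup>2 - u0\<^sup>2) * sin (of_int p * t + \<phi>), u0]"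
    "horizontal_degree R u = of_int p"
proof -
  define \<rho> where "\<rho> = sqrt (R\<^sup>2 - u0\<^sup>2)"
  have "u0\<^sup>2 < R\<^sup>2" using u0 power2_strict_mono[of u0 R] by simp
  then have \<rho>: "\<rho> > 0" "\<rho>\<^sup>2 = R\<^sup>2 - u0\<^sup>2" by (auto simp: \<rho>_def)
  have hor: "(x t $ 1)\<^sup>2 + (x t $ 2)\<^sup>2 = \<rho>\<^sup>2" for t using sphere[of t] by (simp add: \<rho> lat)
  have y3: "y t $ 3 = 0" for t
    using x_nth_deriv[where i = 3 and t = t and S = UNIV] DERIV_unique[of "\<lambda>t. x t $ 3" "y t $ 3" t 0] by (simp add: lat)
  define \<omega> where "\<omega> = (C_at l x 0 - l * u0) / \<rho>\<^sup>2"
  have m3: "m t $ 3 = \<omega> * \<rho>\<^sup>2" for t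
  proof -
    have "m t $ 3 = C_at l x 0 - l * u0" using C_constant[of t] lat[of t] by (simp add: C_at_def)
    then show ?thesis using \<rho>(1) by (simp add: \<omega>_def)
  qed
  have rad: "x t $ 1 * y t $ 1 + x t $ 2 * y t $ 2 = 0" for t using tangent[of t] by (simp add: y3)
  \<comment> \<open>The horizontal velocity is resolved into its radial part, zero by
    \<open>rad\<close>, and its angular part, known from \<open>m3\<close>; multiplication by the
    squared radius avoids a division.\<close>
  have y1: "y t $ 1 = - \<omega> * x t $ 2" for t
  proof -
    have "\<rho>\<^sup>2 * y t $ 1 = x t $ 1 * (x t $ 1 * y t $ 1 + x t $ 2 * y t $ 2) - x t $ 2 * m t $ 3"
      unfolding hor[of t, symmetric] m_nth by (simp add: power2_eq_square algebra_simps)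
    then have "\<rho>\<^sup>2 * y t $ 1 = \<rho>\<^sup>2 * (- \<omega> * x t $ 2)" by (simp add: rad m3 mult.commute)
    then show ?thesis by (subst (asm) mult_left_cancel) (use \<rho>(1) in simp_all)
  qed
  have y2: "y t $ 2 = \<omega> * x t $ 1" for t
  proof -
    have "\<rho>\<^sup>2 * y t $ 2 = x t $ 2 * (x t $ 1 * y t $ 1 + x t $ 2 * y t $ 2) + x t $ 1 * m t $ 3"
      unfolding hor[of t, symmetric] m_nth by (simp add: power2_eq_square algebra_simps)
    then have "\<rho>\<^sup>2 * y t $ 2 = \<rho>\<^sup>2 * (\<omega> * x t $ 1)" by (simp add: rad m3 mult.commute)
    then show ?thesis by (subst (asm) mult_left_cancel) (use \<rho>(1) in simp_all)
  qed
  define z where "z = (\<lambda>t. horizontal (x t))"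
  define w where "w = \<i> * of_real \<omega>"
  have dz: "(z has_vector_derivative w * z t) (at t)" for t
  proof -
    have "(z has_vector_derivative horizontal (y t)) (at t)"
      unfolding z_def by (rule bounded_linear.has_vector_derivative[OF bounded_linear_horizontal x_deriv])
    moreover have "horizontal (y t) = w * z t"
      by (simp add: horizontal_def z_def w_def complex_eq_iff y1 y2)
    ultimately show ?thesis by simp
  qed
  have zc: "z t * exp (- (w * of_real t)) = z 0 * exp (- (w * of_real 0))" for t
  proof (rule constant_of_vector_derivative_zero[of UNIV])
    fix t :: real
    have "((\<lambda>s. exp (- (w * s))) has_field_derivative - w * exp (- (w * of_real t))) (at (of_real t))"
      by (auto intro!: derivative_eq_intros)
    then have e: "((\<lambda>t. exp (- (w * of_real t))) has_vector_derivative - w * exp (- (w * of_real t))) (at t)"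
      by (rule has_vector_derivative_real_field)
    show "((\<lambda>t. z t * exp (- (w * of_real t))) has_vector_derivative 0) (at t)"
      using has_vector_derivative_mult[OF dz e] by (simp add: algebra_simps)
  qed auto
  have zt: "z t = z 0 * exp (w * of_real t)" for t
    using zc[of t] by (simp add: exp_minus field_simps)
  have z0: "cmod (z 0) = \<rho>"
    using hor[of 0] \<rho>(1) by (simp add: z_def horizontal_def cmod_def)
  have "z (2*pi) = z 0" using x_periodic[of 0] by (simp add: z_def)
  then have "exp (w * of_real (2*pi)) = 1" using zt[of "2*pi"] z0 \<rho>(1) by auto
  then obtain p :: int where "\<omega> * (2*pi) = of_int (2 * p) * pi" by (auto simp: exp_eq_1 w_def)
  then have p: "\<omega> = of_int p" by simp
  define \<phi> where "\<phi> = Arg (z 0)"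
  have "z t = rcis \<rho> (of_int p * t + \<phi>)" for t
  proof -
    have "z 0 = rcis \<rho> \<phi>" using rcis_cmod_Arg[of "z 0"] z0 by (simp add: \<phi>_def)
    moreover have "exp (w * of_real t) = cis (of_int p * t)" by (simp add: w_def p cis_conv_exp mult.assoc)
    ultimately show ?thesis by (simp add: zt[of t] rcis_def cis_mult add.commute mult.assoc)
  qed
  then have "Re (z t) = \<rho> * cos (of_int p * t + \<phi>) \<and> Im (z t) = \<rho> * sin (of_int p * t + \<phi>)" for t by simp
  then have form: "x t = vector [\<rho> * cos (of_int p * t + \<phi>), \<rho> * sin (of_int p * t + \<phi>), u0]" for t
    unfolding vec3_eq_iff using lat[of t] by (simp add: z_def horizontal_def)
  have eq: "u0 * (of_int p)\<^sup>2 = l * (of_int p - 1)"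
  proof -
    have I: "0 \<in> {0..2*pi}" by simp
    \<comment> \<open>The moment equation is one-sided at angle 0, so it is compared with the
      explicit derivative within the closed period, where derivatives are still unique.\<close>
    have uniq: "d = d'" if "(f has_real_derivative d) (at 0 within {0..2*pi})" "(f has_real_derivative d') (at 0 within {0..2*pi})" for f d d'
      using vector_derivative_unique_within_closed_interval[of 0 "2*pi" 0 f d d'] that
      by (simp add: has_real_derivative_iff_has_vector_derivative)
    \<comment> \<open>Here the first moment component is \<open>- u0 * \<omega>\<close> times
      \<open>x1\<close>, so no second derivative of the orbit enters.\<close>
    have d1: "((\<lambda>t. m t $ 1) has_real_derivative (- u0 * \<omega>) * y 0 $ 1) (at 0 within {0..2*pi})"
      unfolding m_nth lat y3 y2 by (auto intro!: derivative_eq_intros x_nth_deriv)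
    have d2: "((\<lambda>t. m t $ 2) has_real_derivative (- u0 * \<omega>) * y 0 $ 2) (at 0 within {0..2*pi})"
      unfolding m_nth lat y3 y1 by (auto intro!: derivative_eq_intros x_nth_deriv)
    have "x 0 $ 2 * (u0 * \<omega>\<^sup>2 - l * (\<omega> - 1)) = 0"
      using uniq[OF d1 m_nth_deriv[OF I]] by (simp add: e_vert_cross_nth y1 power2_eq_square algebra_simps)
    moreover have "x 0 $ 1 * (u0 * \<omega>\<^sup>2 - l * (\<omega> - 1)) = 0"
      using uniq[OF d2 m_nth_deriv[OF I]] by (simp add: e_vert_cross_nth y2 power2_eq_square algebra_simps)
    moreover have "x 0 $ 1 \<noteq> 0 \<or> x 0 $ 2 \<noteq> 0" using hor[of 0] \<rho>(1) by auto
    ultimately show ?thesis by (auto simp: p)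
  qed
  \<comment> \<open>For \<open>p = 0\<close> the relation would read \<open>0 = - l\<close>.\<close>
  have p0: "p \<noteq> 0" using eq l_pos by auto
  have "angular_speed R u = (\<lambda>_. of_int p)"
    unfolding hor unfolding m_nth(3)[symmetric] m3 using \<rho>(1) by (simp add: p)
  then have "horizontal_degree R u = of_int p" unfolding horizontal_degree_eq by simp
  then show thesis
    using p0 eq form by (intro that[of p \<phi>]) (auto simp: \<rho>_def field_simps)
qed

end

lemma horizontal_degree_0: assumes "R > 0" shows "horizontal_degree R (\<lambda>_. 0) = 1"
proof -
  have eq: "orbit R (\<lambda>_. 0) = x0 R" by (simp add: orbit_def fun_eq_iff)
  have den: "(x0 R t $ 1)\<^sup>2 + (x0 R t $ 2)\<^sup>2 = R\<^sup>2" for t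
    by (simp add: x0_def power_mult_distrib flip: distrib_left)
  have num: "x0 R t $ 1 * vd (x0 R) t $ 2 - x0 R t $ 2 * vd (x0 R) t $ 1 = R\<^sup>2" for t
    using den[of t] by (simp add: vd_x0 x0_def power2_eq_square)
  have "angular_speed R (\<lambda>_. 0) = (\<lambda>_. 1)"
    unfolding eq den num using assms by simp
  then show ?thesis unfolding horizontal_degree_eq by simp
qed

section \<open>Boundary sequences\<close>

text \<open>Each minimum is compared with the value of its function at a minimiser of the other; the
  minimisers themselves need not converge.\<close>

lemma min_of_uniform_limit:
  assumes f: "uniform_limit UNIV f g sequentially" and e: "\<And>n. is_min_of (e n) (f n)" and m: "is_min_of m g"
  shows "e \<longlonglongrightarrow> m"
proof (rule tendstoI)
  fix d :: real assume d: "d > 0"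
  show "eventually (\<lambda>n. dist (e n) m < d) sequentially"
    using uniform_limitD[OF f d]
  proof eventually_elim
    case (elim n)
    obtain s t where s: "f n s = e n" and t: "g t = m" using e[of n] m by (auto simp: is_min_of_def)
    have "m \<le> g s" "e n \<le> f n t" using e[of n] m by (auto simp: is_min_of_def)
    moreover have "\<bar>f n s - g s\<bar> < d" "\<bar>f n t - g t\<bar> < d" using elim by (auto simp: dist_real_def)
    ultimately show ?case using s t by (simp add: dist_real_def)
  qed
qed

lemma max_of_uniform_limit:
  assumes f: "uniform_limit UNIV f g sequentially" and e: "\<And>n. is_max_of (e n) (f n)" and m: "is_max_of m g"
  shows "e \<longlonglongrightarrow> m"
proof -
  have "(\<lambda>n. - e n) \<longlonglongrightarrow> - m"
  proof (rule min_of_uniform_limit)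
    show "uniform_limit UNIV (\<lambda>n t. - f n t) (\<lambda>t. - g t) sequentially"
      by (intro uniform_limit_intros f)
    show "is_min_of (- e n) (\<lambda>t. - f n t)" for n using e[of n] by (auto simp: is_min_of_def is_max_of_def)
    show "is_min_of (- m) (\<lambda>t. - g t)" using m by (auto simp: is_min_of_def is_max_of_def)
  qed
  from tendsto_minus[OF this] show ?thesis by simp
qed

lemma H2_dist_orbit_nth_uniform_limit:
  assumes "\<And>n. us n \<in> H2" "u \<in> H2" "(\<lambda>n. H2_dist (us n) u) \<longlonglongrightarrow> 0"
  shows "uniform_limit S (\<lambda>n t. orbit R (us n) t $ i) (\<lambda>t. orbit R u t $ i) sequentially"
  unfolding orbit_def
  by (intro bounded_linear.uniform_limit[OF bounded_linear_vec_nth] uniform_limit_intros H2_dist_imp_uniform_limit(1) assms)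

lemma vert_poly_tendsto:
  assumes R: "R > 0" and us: "\<And>n. us n \<in> H2" and u: "u \<in> H2" and l: "l > 0" "ls \<longlonglongrightarrow> l"
    and lim: "(\<lambda>n. H2_dist (us n) u) \<longlonglongrightarrow> 0"
  shows "(\<lambda>n. vert_poly R (ls n) (us n) s) \<longlonglongrightarrow> vert_poly R l u s"
proof -
  have x: "(\<lambda>n. orbit R (us n) 0 $ i) \<longlonglongrightarrow> orbit R u 0 $ i" for i
    using tendsto_uniform_limitI[OF H2_dist_orbit_nth_uniform_limit[OF us u lim, where S = UNIV]] by blast
  have "(\<lambda>n. vd (us n) 0) \<longlonglongrightarrow> vd u 0"
    using tendsto_uniform_limitI[OF H2_dist_imp_uniform_limit(2)[OF us u lim, where S = UNIV]] by blast
  then have y: "(\<lambda>n. vd (orbit R (us n)) 0) \<longlonglongrightarrow> vd (orbit R u) 0"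
    unfolding vd_orbit[OF us] vd_orbit[OF u] by (intro tendsto_intros)
  have y': "(\<lambda>n. vd (orbit R (us n)) 0 $ i) \<longlonglongrightarrow> vd (orbit R u) 0 $ i" for i
    by (intro tendsto_vec_nth y)
  have C: "(\<lambda>n. C_at (ls n) (orbit R (us n)) 0) \<longlonglongrightarrow> C_at l (orbit R u) 0"
    unfolding C_at_def cross3_def vector_3 by (intro tendsto_intros x y' l(2))
  have E: "(\<lambda>n. E_at (ls n) (orbit R (us n)) 0) \<longlonglongrightarrow> E_at l (orbit R u) 0"
    unfolding E_at_def by (intro tendsto_intros x y y' l(2)) simp_all
  show ?thesis
    unfolding vert_poly_def Let_def by (intro tendsto_intros C E l(2)) (use R l(1) in auto)
qed

lemma (in zero_set_solution) extrema_exist: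
  obtains m1 m2 where "is_min_of m1 (\<lambda>t. x t $ 3)" "is_max_of m2 (\<lambda>t. x t $ 3)"
proof -
  have c: "continuous_on {0..2*pi} (\<lambda>t. x t $ 3)" by (intro continuous_intros x_continuous)
  obtain s where s: "s \<in> {0..2*pi}" "\<And>t. t \<in> {0..2*pi} \<Longrightarrow> x s $ 3 \<le> x t $ 3"
    using continuous_attains_inf[OF _ _ c] by auto
  obtain s' where s': "s' \<in> {0..2*pi}" "\<And>t. t \<in> {0..2*pi} \<Longrightarrow> x t $ 3 \<le> x s' $ 3"
    using continuous_attains_sup[OF _ _ c] by auto
  have "\<exists>s\<in>{0..2*pi}. x s = x t" for t
    using shift_into_period[of t] periodic_shift_int[of x t, OF x_periodic] by metis
  then have "x s $ 3 \<le> x t $ 3" "x t $ 3 \<le> x s' $ 3" for t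
    using s(2) s'(2) by metis+
  then show thesis by (intro that[of "x s $ 3" "x s' $ 3"]) (auto simp: is_min_of_def is_max_of_def)
qed

lemma boundary_sequence_limits:
  assumes R: "R > 0" and bs: "boundary_sequence R ls us l u e1 e2 e3"
  obtains m1 m2 m3 where "e1 \<longlonglongrightarrow> m1" "e2 \<longlonglongrightarrow> m2" "e3 \<longlonglongrightarrow> m3"
    "is_min_of m1 (\<lambda>t. orbit R u t $ 3)" "is_max_of m2 (\<lambda>t. orbit R u t $ 3)"
    "\<And>s. vert_poly R l u s = 2 * l / R\<^sup>2 * (s - m1) * (s - m2) * (s - m3)"
    "m1 = - R \<or> m2 = R \<or> m1 = m2" "m2 = m3 \<Longrightarrow> m1 = m2"
proof -
  have Z: "(ls n, us n) \<in> Z R" and roots: "assoc_roots R (ls n) (us n) (e1 n) (e2 n) (e3 n)" for n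
    using bs by (auto simp: boundary_sequence_def Zreg_def)
  have lsl: "ls \<longlonglongrightarrow> l" and lim: "(\<lambda>n. H2_dist (us n) u) \<longlonglongrightarrow> 0" and Zu: "(l, u) \<in> Z R" and nreg: "(l, u) \<notin> Zreg R"
    using bs by (auto simp: boundary_sequence_def)
  interpret zero_set_solution R l u by unfold_locales (use R Zu in auto)
  have us: "us n \<in> H2" for n using Z[of n] by (auto simp: Z_def)
  obtain m1 m2 where m: "is_min_of m1 (\<lambda>t. x t $ 3)" "is_max_of m2 (\<lambda>t. x t $ 3)" by (rule extrema_exist)
  note ul = H2_dist_orbit_nth_uniform_limit[OF us u_H2 lim, where S = UNIV and R = R and i = 3]
  have e1: "e1 \<longlonglongrightarrow> m1" by (rule min_of_uniform_limit[OF ul _ m(1)]) (use roots in \<open>simp add: assoc_roots_def\<close>)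
  have e2: "e2 \<longlonglongrightarrow> m2" by (rule max_of_uniform_limit[OF ul _ m(2)]) (use roots in \<open>simp add: assoc_roots_def\<close>)
  have bnd: "- R \<le> m1" "m1 \<le> m2" "m2 \<le> R"
    using m abs_x3_le by (auto simp: is_min_of_def is_max_of_def abs_le_iff) (metis minus_le_iff)
  have P: "vert_poly R (ls n) (us n) s = 2 * ls n / R\<^sup>2 * (s - e1 n) * (s - e2 n) * (s - e3 n)" for n s
    using roots by (simp add: assoc_roots_def)
  note Plim = vert_poly_tendsto[OF R us u_H2 l_pos lsl lim]
  \<comment> \<open>This height lies above all \<open>e1 n\<close>, \<open>e2 n\<close> and their
    limits. So \<open>K n\<close> and its limit are nonzero, and the factored polynomial at
    \<open>a\<close> can be solved for the third root, which therefore converges.\<close>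
  define a where "a = R + 1"
  define K where "K = (\<lambda>n. 2 * ls n / R\<^sup>2 * (a - e1 n) * (a - e2 n))"
  have K: "K \<longlonglongrightarrow> 2 * l / R\<^sup>2 * (a - m1) * (a - m2)"
    unfolding K_def by (intro tendsto_intros lsl e1 e2) (use R in simp)
  have K0: "2 * l / R\<^sup>2 * (a - m1) * (a - m2) \<noteq> 0"
    using l_pos R bnd by (auto simp: a_def)
  have e3_eq: "e3 n = a - vert_poly R (ls n) (us n) a / K n" for n
  proof -
    have "ls n > 0" using Z[of n] by (auto simp: Z_def)
    moreover have "e1 n < R" "e2 n < R" using roots[of n] by (auto simp: assoc_roots_def)
    ultimately have "K n \<noteq> 0" using R by (auto simp: K_def a_def)
    then show ?thesis unfolding P K_def[symmetric] by (simp add: K_def)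
  qed
  define m3 where "m3 = a - vert_poly R l u a / (2 * l / R\<^sup>2 * (a - m1) * (a - m2))"
  have e3: "e3 \<longlonglongrightarrow> m3"
    unfolding e3_eq[abs_def] m3_def by (intro tendsto_intros Plim K K0)
  have PP: "vert_poly R l u s = 2 * l / R\<^sup>2 * (s - m1) * (s - m2) * (s - m3)" for s
  proof (rule LIMSEQ_unique[OF Plim])
    show "(\<lambda>n. vert_poly R (ls n) (us n) s) \<longlonglongrightarrow> 2 * l / R\<^sup>2 * (s - m1) * (s - m2) * (s - m3)"
      unfolding P by (intro tendsto_intros lsl e1 e2 e3) (use R in simp)
  qed
  have "m2 \<le> m3"
    by (rule LIMSEQ_le[OF e2 e3]) (use roots in \<open>auto simp: assoc_roots_def intro: less_imp_le\<close>)
  \<comment> \<open>For equal upper roots the gap estimate bounds \<open>m3 - m1\<close> by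
    0.\<close>
  have dbl: "m1 = m2" if "m2 = m3"
    using root_gap_estimate[OF m \<open>m2 \<le> m3\<close> PP] that bnd by simp
  \<comment> \<open>Were all three alternatives false, the limits would be strictly ordered roots
    inside the sphere and the limiting solution would belong to \<open>Zreg\<close>.\<close>
  have "m1 = - R \<or> m2 = R \<or> m1 = m2"
  proof (rule ccontr)
    assume c: "\<not> ?thesis"
    then have "m2 \<noteq> m3" using dbl by blast
    then have ar: "assoc_roots R l u m1 m2 m3"
      using c m bnd \<open>m2 \<le> m3\<close> PP by (auto simp: assoc_roots_def)
    moreover have "- R < x t $ 3 \<and> x t $ 3 < R" for t
      using c m bnd by (auto simp: is_min_of_def is_max_of_def) (metis le_less_trans less_le less_le_trans)+
    moreover have "\<not> (\<exists>c. \<forall>t. x t $ 3 = c)"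
      using c m unfolding is_min_of_def is_max_of_def by metis
    ultimately have "(l, u) \<in> Zreg R" using Zu by (auto simp: Zreg_def)
    then show False using nreg by simp
  qed
  then show thesis using that[OF e1 e2 e3 m PP] dbl by blast
qed

lemma (in zero_set_solution) alt_collapseI:
  assumes lim: "(\<lambda>n. e2 n - e1 n) \<longlonglongrightarrow> 0" and const: "\<And>t. x t $ 3 = u0"
  shows "alt_collapse R l u e1 e2"
  unfolding alt_collapse_def Let_def
proof (intro conjI lim exI[of _ u0] allI impI)
  show "- R \<le> u0" "u0 \<le> R" using abs_x3_le[of 0] const[of 0] by auto
  show "x t $ 3 = u0" for t by (rule const)
  show "\<exists>(p::int) \<phi>. p \<noteq> 0 \<and> u0 = l * (real_of_int p - 1) / (real_of_int p)\<^sup>2 \<and>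
     (\<forall>\<eta>. x \<eta> = vector [sqrt (R\<^sup>2 - u0\<^sup>2) * cos (real_of_int p * \<eta> + \<phi>), sqrt (R\<^sup>2 - u0\<^sup>2) * sin (real_of_int p * \<eta> + \<phi>), u0])"
    if "\<bar>u0\<bar> < R"
    by (rule constant_latitude[OF const that]) blast
  have pole: "x t = vector [0, 0, u0]" if "u0\<^sup>2 = R\<^sup>2" for t
    using sphere[of t] const[of t] that by (simp add: vec3_eq_iff sum_power2_eq_zero_iff)
  show "x t = vector [0, 0, R]" if "u0 = R" for t using pole that by simp
  show "x t = vector [0, 0, - R]" if "u0 = - R" for t using pole that by simp
qed

text \<open>Degree 1 means \<open>p = 1\<close>, so the latitude formula gives height 0. What
  remains is the equator run through with a phase, which the opposite rotation of the orbit
  removes.\<close>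

lemma (in zero_set_solution) latitude_degree_one:
  assumes const: "\<And>t. x t $ 3 = u0" "\<bar>u0\<bar> < R" and deg: "horizontal_degree R u = 1"
  shows "u0 = 0" "\<exists>\<phi>. (l, rotate_orbit R \<phi> u) \<in> equatorial_branch"
proof -
  obtain p :: int and \<phi> where p: "u0 = l * (of_int p - 1) / (of_int p)\<^sup>2"
    "\<And>t. x t = vector [sqrt (R\<^sup>2 - u0\<^sup>2) * cos (of_int p * t + \<phi>), sqrt (R\<^sup>2 - u0\<^sup>2) * sin (of_int p * t + \<phi>), u0]"
    "horizontal_degree R u = of_int p"
    by (rule constant_latitude[OF const]) (rule that; assumption)
  have p1: "of_int p = (1::real)" using p(3) deg by simp
  then show u0: "u0 = 0" using p(1) by simp
  have x: "x t = vector [R * cos (t + \<phi>), R * sin (t + \<phi>), 0]" for t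
    using p(2)[of t] R_pos by (simp add: p1 u0)
  have "rotate_orbit R (- \<phi>) u t = 0" for t
  proof -
    have "cos (- \<phi>) * (R * cos (t + \<phi>)) - sin (- \<phi>) * (R * sin (t + \<phi>)) = R * cos (t + \<phi> - \<phi>)"
      unfolding cos_diff by (simp add: algebra_simps)
    moreover have "sin (- \<phi>) * (R * cos (t + \<phi>)) + cos (- \<phi>) * (R * sin (t + \<phi>)) = R * sin (t + \<phi> - \<phi>)"
      unfolding sin_diff by (simp add: algebra_simps)
    ultimately have "rot (- \<phi>) (x t) = x0 R t"
      unfolding rot_def x x0_def vector_3 by simp
    then show ?thesis by (simp add: rotate_orbit_def)
  qed
  then have "rotate_orbit R (- \<phi>) u = (\<lambda>_. 0)" by blast
  then show "\<exists>\<phi>. (l, rotate_orbit R \<phi> u) \<in> equatorial_branch"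
    using l_pos by (auto simp: equatorial_branch_def)
qed

text \<open>All three root sequences converge as a whole, so a limit observed along any subsequence
  \<open>r\<close> is already the full limit and hence a property of \<open>u\<close>
  itself.\<close>

lemma boundary_sequence_alternatives:
  assumes R: "R > 0" and bs: "boundary_sequence R ls us l u e1 e2 e3"
  shows "strict_mono r \<Longrightarrow> (e1 \<circ> r) \<longlonglongrightarrow> - R \<Longrightarrow> alt_south R l u (e1 \<circ> r)"
    and "strict_mono r \<Longrightarrow> (e2 \<circ> r) \<longlonglongrightarrow> R \<Longrightarrow> alt_north R l u (e2 \<circ> r)"
    and "strict_mono r \<Longrightarrow> (\<lambda>n. e2 (r n) - e1 (r n)) \<longlonglongrightarrow> 0 \<Longrightarrow> alt_collapse R l u (e1 \<circ> r) (e2 \<circ> r)"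
    and "strict_mono r \<Longrightarrow> (\<lambda>n. e3 (r n) - e2 (r n)) \<longlonglongrightarrow> 0 \<Longrightarrow> (\<lambda>n. e2 (r n) - e1 (r n)) \<longlonglongrightarrow> 0"
    and "e1 \<longlonglongrightarrow> - R \<or> e2 \<longlonglongrightarrow> R \<or> (\<lambda>n. e2 n - e1 n) \<longlonglongrightarrow> 0"
    and "is_min_of v1 (\<lambda>t. orbit R u t $ 3) \<Longrightarrow> e1 \<longlonglongrightarrow> v1"
    and "is_max_of v2 (\<lambda>t. orbit R u t $ 3) \<Longrightarrow> e2 \<longlonglongrightarrow> v2"
proof -
  interpret zero_set_solution R l u by unfold_locales (use R bs in \<open>auto simp: boundary_sequence_def\<close>)
  obtain m1 m2 m3 where e: "e1 \<longlonglongrightarrow> m1" "e2 \<longlonglongrightarrow> m2" "e3 \<longlonglongrightarrow> m3"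
    and m: "is_min_of m1 (\<lambda>t. x t $ 3)" "is_max_of m2 (\<lambda>t. x t $ 3)"
    and P: "\<And>s. vert_poly R l u s = 2 * l / R\<^sup>2 * (s - m1) * (s - m2) * (s - m3)"
    and alt: "m1 = - R \<or> m2 = R \<or> m1 = m2" "m2 = m3 \<Longrightarrow> m1 = m2"
    by (rule boundary_sequence_limits[OF R bs]) (blast intro: that)
  show "e1 \<longlonglongrightarrow> - R \<or> e2 \<longlonglongrightarrow> R \<or> (\<lambda>n. e2 n - e1 n) \<longlonglongrightarrow> 0"
    using alt(1) e tendsto_diff[OF e(2,1)] by auto
  show "e1 \<longlonglongrightarrow> v1" if "is_min_of v1 (\<lambda>t. x t $ 3)"
    using that m(1) e(1) unfolding is_min_of_def by (metis order_antisym)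
  show "e2 \<longlonglongrightarrow> v2" if "is_max_of v2 (\<lambda>t. x t $ 3)"
    using that m(2) e(2) unfolding is_max_of_def by (metis order_antisym)
  assume r: "strict_mono r"
  note er = e[THEN LIMSEQ_subseq_LIMSEQ[OF _ r]]
  have dr: "(\<lambda>n. e2 (r n) - e1 (r n)) \<longlonglongrightarrow> m2 - m1" "(\<lambda>n. e3 (r n) - e2 (r n)) \<longlonglongrightarrow> m3 - m2"
    using tendsto_diff[OF er(2,1)] tendsto_diff[OF er(3,2)] by (simp_all add: o_def)
  show "alt_south R l u (e1 \<circ> r)" if "(e1 \<circ> r) \<longlonglongrightarrow> - R"
  proof -
    have "m1 = - R" using LIMSEQ_unique[OF er(1) that] .
    then show ?thesis using that P[of "- R"] pole_root_imp_C(2) by (simp add: alt_south_def)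
  qed
  show "alt_north R l u (e2 \<circ> r)" if "(e2 \<circ> r) \<longlonglongrightarrow> R"
  proof -
    have "m2 = R" using LIMSEQ_unique[OF er(2) that] .
    then show ?thesis using that P[of R] pole_root_imp_C(1) by (simp add: alt_north_def)
  qed
  show "alt_collapse R l u (e1 \<circ> r) (e2 \<circ> r)" if c: "(\<lambda>n. e2 (r n) - e1 (r n)) \<longlonglongrightarrow> 0"
  proof (rule alt_collapseI)
    have "m1 = m2" using LIMSEQ_unique[OF dr(1) c] by simp
    then show "x t $ 3 = m1" for t using m unfolding is_min_of_def is_max_of_def by (metis order_antisym)
  qed (use c in \<open>simp add: o_def\<close>)
  show "(\<lambda>n. e2 (r n) - e1 (r n)) \<longlonglongrightarrow> 0" if c: "(\<lambda>n. e3 (r n) - e2 (r n)) \<longlonglongrightarrow> 0"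
    using LIMSEQ_unique[OF dr(2) c] alt(2) dr(1) by simp
qed

text \<open>No limiting solution is given here, so the gap estimate is applied to every member; a
  bound \<open>L\<close> on the parameters makes its exponential factor uniform.\<close>

lemma root_gap_collapse:
  assumes R: "R > 0" and Z: "\<And>n. (ls n, us n) \<in> Z R" and roots: "\<And>n. assoc_roots R (ls n) (us n) (e1 n) (e2 n) (e3 n)"
    and bdd: "bounded (range ls)" and lim: "(\<lambda>n. e3 n - e2 n) \<longlonglongrightarrow> 0"
  shows "(\<lambda>n. e2 n - e1 n) \<longlonglongrightarrow> 0"
proof -
  obtain L where L: "\<And>n. ls n \<le> L" using bdd by (auto simp: bounded_iff abs_le_iff)
  define K where "K = exp (4 * pi * sqrt (L / R))"
  have le: "0 \<le> e2 n - e1 n \<and> e2 n - e1 n \<le> (e3 n - e2 n) * K" for n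
  proof -
    interpret zero_set_solution R "ls n" "us n" by unfold_locales (use R Z in auto)
    have e: "is_min_of (e1 n) (\<lambda>t. x t $ 3)" "is_max_of (e2 n) (\<lambda>t. x t $ 3)" "e1 n < e2 n" "e2 n < e3 n"
      "\<And>s. vert_poly R (ls n) (us n) s = 2 * ls n / R\<^sup>2 * (s - e1 n) * (s - e2 n) * (s - e3 n)"
      using roots[of n] by (auto simp: assoc_roots_def)
    have "e3 n - e1 n \<le> (e3 n - e2 n) * exp (4 * pi * sqrt (ls n / R))"
      by (rule root_gap_estimate[OF e(1,2) _ e(5)]) (use e(4) in simp)
    also have "\<dots> \<le> (e3 n - e2 n) * K"
      unfolding K_def using e(4) L[of n] R by (intro mult_left_mono) (auto intro!: mult_left_mono divide_right_mono)
    finally show ?thesis using e(3,4) by simp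
  qed
  have K: "(\<lambda>n. (e3 n - e2 n) * K) \<longlonglongrightarrow> 0" using tendsto_mult_left_zero[OF lim] by simp
  show ?thesis by (rule tendsto_sandwich[OF _ _ tendsto_const K]) (use le in auto)
qed

section \<open>Components of the regular class\<close>

text \<open>A level set and its complement are both open in \<open>S\<close>, and a connected set
  cannot meet both.\<close>

lemma (in Metric_space) locally_constant_on_connectedin:
  assumes S: "S \<subseteq> M" and loc: "\<And>p. p \<in> S \<Longrightarrow> \<exists>r>0. \<forall>q\<in>S. d p q < r \<longrightarrow> f q = f p"
    and B: "connectedin (subtopology mtopology S) B" and ab: "a \<in> B" "b \<in> B"
  shows "f a = f b"
proof -
  interpret sub: Submetric M d S by unfold_locales (rule S)
  have op: "openin (subtopology mtopology S) {p \<in> S. P (f p)}" for P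
  proof -
    have "openin sub.sub.mtopology {p \<in> S. P (f p)}"
    proof (subst sub.sub.openin_mtopology, intro conjI allI impI)
      fix p assume p: "p \<in> {p \<in> S. P (f p)}"
      then obtain r where r: "r > 0" "\<forall>q\<in>S. d p q < r \<longrightarrow> f q = f p" using loc by blast
      have "sub.sub.mball p r \<subseteq> {p \<in> S. P (f p)}"
      proof
        fix q assume "q \<in> sub.sub.mball p r"
        then have q: "q \<in> S" "d p q < r" by simp_all
        then have "f q = f p" using r(2) by blast
        then show "q \<in> {p \<in> S. P (f p)}" using p q(1) by simp
      qed
      with r(1) show "\<exists>r>0. sub.sub.mball p r \<subseteq> {p \<in> S. P (f p)}" by (intro exI conjI)
    qed (rule Collect_restrict)
    then show ?thesis by (simp only: sub.mtopology_submetric)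
  qed
  have BS: "B \<subseteq> S" using connectedin_subset_topspace[OF B] by simp
  show ?thesis
  proof (rule ccontr)
    assume ne: "f a \<noteq> f b"
    let ?E1 = "{p \<in> S. f p = f a}" and ?E2 = "{p \<in> S. f p \<noteq> f a}"
    have "openin (subtopology mtopology S) ?E1" "openin (subtopology mtopology S) ?E2"
      using op[of "\<lambda>v. v = f a"] op[of "\<lambda>v. v \<noteq> f a"] by simp_all
    moreover have "B \<subseteq> ?E1 \<union> ?E2" "?E1 \<inter> ?E2 \<inter> B = {}" "?E1 \<inter> B \<noteq> {}" "?E2 \<inter> B \<noteq> {}"
      using BS ab ne by auto
    ultimately show False using B unfolding connectedin by meson
  qed
qed
lemma Zreg_horizontal_nonzero:
  assumes "R > 0" "(l, u) \<in> Zreg R"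
  shows "(orbit R u t $ 1)\<^sup>2 + (orbit R u t $ 2)\<^sup>2 \<noteq> 0"
proof -
  interpret zero_set_solution R l u by unfold_locales (use assms in \<open>auto simp: Zreg_def\<close>)
  have "\<bar>x t $ 3\<bar> < R" using assms(2) by (auto simp: Zreg_def abs_less_iff minus_less_iff)
  then show ?thesis by (rule horizontal_nonzero)
qed

lemma Zreg_H2: "(l, u) \<in> Zreg R \<Longrightarrow> u \<in> H2" and Zreg_pos: "(l, u) \<in> Zreg R \<Longrightarrow> l > 0"
  by (auto simp: Zreg_def Z_def)

lemma Ints_eventually_eq:
  fixes c :: real
  assumes "f \<longlonglongrightarrow> c" "\<And>n. f n \<in> \<int>" "c \<in> \<int>"
  shows "eventually (\<lambda>n. f n = c) sequentially"
proof -
  have "eventually (\<lambda>n. dist (f n) c < 1) sequentially" by (rule tendstoD[OF assms(1)]) simp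
  then show ?thesis
  proof eventually_elim
    case (elim n)
    then show ?case using Ints_eq_abs_less1[OF assms(2,3)] by (simp add: dist_real_def)
  qed
qed

lemma horizontal_degree_component:
  assumes R: "R > 0" and B: "B \<in> connected_components_of (subtopology pair_topology (Zreg R))"
    and ab: "(l, u) \<in> B" "(l', u') \<in> B"
  shows "horizontal_degree R u = horizontal_degree R u'"
proof -
  interpret Metric_space "{0<..} \<times> H2" "\<lambda>(l::real, u) (m, v). \<bar>l - m\<bar> + H2_dist u v"
    by (rule Metric_space_pair)
  have "(\<lambda>p. horizontal_degree R (snd p)) (l, u) = (\<lambda>p. horizontal_degree R (snd p)) (l', u')"
  proof (rule locally_constant_on_connectedin[where S = "Zreg R"])
    show "Zreg R \<subseteq> {0<..} \<times> H2" by (auto simp: Zreg_H2 Zreg_pos)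
    show "connectedin (subtopology mtopology (Zreg R)) B"
      using connectedin_connected_components_of[OF B] by (simp add: pair_topology_def)
    fix p assume "p \<in> Zreg R"
    then obtain l u where p: "p = (l, u)" "(l, u) \<in> Zreg R" by (cases p) auto
    show "\<exists>r>0. \<forall>q\<in>Zreg R. (case p of (l, u) \<Rightarrow> \<lambda>(m, v). \<bar>l - m\<bar> + H2_dist u v) q < r \<longrightarrow>
        horizontal_degree R (snd q) = horizontal_degree R (snd p)"
    \<comment> \<open>A failure of local constancy yields points of \<open>Zreg\<close> at distance
      below \<open>1 / (n + 1)\<close> with a different degree. Their degrees converge to that of
      \<open>u\<close>, and convergent integers with an integer limit eventually equal it.\<close>
    proof (rule ccontr)
      assume neg: "\<not> ?thesis"
      have "\<exists>m v. (m, v) \<in> Zreg R \<and> \<bar>l - m\<bar> + H2_dist u v < r \<and> horizontal_degree R v \<noteq> horizontal_degree R u" if "r > 0" for r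
        using neg that unfolding p(1) by force
      then have "\<exists>m v. (m, v) \<in> Zreg R \<and> \<bar>l - m\<bar> + H2_dist u v < inverse (real (Suc n)) \<and> horizontal_degree R v \<noteq> horizontal_degree R u" for n
        by simp
      then obtain ms vs where v: "\<And>n. (ms n, vs n) \<in> Zreg R" "\<And>n. \<bar>l - ms n\<bar> + H2_dist u (vs n) < inverse (real (Suc n))"
        "\<And>n. horizontal_degree R (vs n) \<noteq> horizontal_degree R u"
        by metis
      have "(\<lambda>n. H2_dist (vs n) u) \<longlonglongrightarrow> 0"
      proof (rule tendsto_sandwich[OF _ _ tendsto_const LIMSEQ_inverse_real_of_nat])
        show "\<forall>\<^sub>F n in sequentially. 0 \<le> H2_dist (vs n) u" by (simp add: H2_dist_nonneg)
        show "\<forall>\<^sub>F n in sequentially. H2_dist (vs n) u \<le> inverse (real (Suc n))"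
        proof (intro always_eventually allI)
          fix n show "H2_dist (vs n) u \<le> inverse (real (Suc n))"
            using v(2)[of n] H2_dist_commute[of u "vs n"] by linarith
        qed
      qed
      note ul = H2_dist_imp_uniform_limit[OF Zreg_H2[OF v(1)] Zreg_H2[OF p(2)] this]
      have "(\<lambda>n. horizontal_degree R (vs n)) \<longlonglongrightarrow> horizontal_degree R u"
        by (intro horizontal_degree_tendsto ul Zreg_H2[OF v(1)] Zreg_H2[OF p(2)]
            Zreg_horizontal_nonzero[OF R v(1)] Zreg_horizontal_nonzero[OF R p(2)])
      then have "\<forall>\<^sub>F n in sequentially. horizontal_degree R (vs n) = horizontal_degree R u"
        by (rule Ints_eventually_eq) (intro horizontal_degree_Ints Zreg_H2[OF v(1)] Zreg_H2[OF p(2)]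
            Zreg_horizontal_nonzero[OF R v(1)] Zreg_horizontal_nonzero[OF R p(2)])+
      then show False using v(3) by simp
    qed
  qed (use ab in auto)
  then show ?thesis by simp
qed

section \<open>The degree near the bifurcation point\<close>

lemma norm_rot: "norm (rot \<phi> a) = norm a"
proof -
  have "(c * p - s * q)\<^sup>2 + (s * p + c * q)\<^sup>2 = (c\<^sup>2 + s\<^sup>2) * (p\<^sup>2 + q\<^sup>2)" for c s p q :: real
    by (simp add: power2_eq_square algebra_simps)
  note eq = this[of "cos \<phi>" _ "sin \<phi>"]
  have "(norm (rot \<phi> a))\<^sup>2 = (norm a)\<^sup>2"
    by (simp add: power2_norm_eq_inner inner_vec_def sum_3 rot_def eq flip: power2_eq_square)
  then show ?thesis by (simp add: power2_eq_iff_nonneg)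
qed

lemma bounded_linear_rot: "bounded_linear (rot \<phi>)"
  unfolding linear_conv_bounded_linear[symmetric]
  by (rule linearI) (simp_all add: rot_def vec_eq_iff forall_3 algebra_simps)

lemma vd_phase_translate:
  assumes "u \<in> H2" shows "vd (phase_translate \<phi> u) t = rot \<phi> (vd u (t - \<phi>))"
proof (rule vector_derivative_at)
  have "((\<lambda>t. t - \<phi>) has_vector_derivative 1) (at t)" 
    by (auto intro!: derivative_eq_intros)
  then have "((u \<circ> (\<lambda>t. t - \<phi>)) has_vector_derivative 1 *\<^sub>R vd u (t - \<phi>)) (at t)"
    by (rule vector_diff_chain_at) (rule H2_has_vd[OF assms])
  from bounded_linear.has_vector_derivative[OF bounded_linear_rot this]
  show "(phase_translate \<phi> u has_vector_derivative rot \<phi> (vd u (t - \<phi>))) (at t)"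
    by (simp add: phase_translate_def[abs_def] o_def)
qed

text \<open>As \<open>U 0 = 0\<close>, the difference quotient at 0 is \<open>U t / t\<close>, which
  converges in H2 to the derivative \<open>V\<close>. It therefore stays bounded, and the embedding
  turns this into a linear bound on values and velocities.\<close>

lemma bifurcation_curve_small:
  assumes bc: "bifurcation_curve R k \<delta> L U"
  obtains K d where "d > 0" "\<And>t \<eta>. t \<noteq> 0 \<Longrightarrow> \<bar>t\<bar> < d \<Longrightarrow> norm (U t \<eta>) \<le> K * \<bar>t\<bar> \<and> norm (vd (U t) \<eta>) \<le> K * \<bar>t\<bar>"
proof -
  have \<delta>: "\<delta> > 0" and UH: "\<And>t. \<bar>t\<bar> < \<delta> \<Longrightarrow> U t \<in> H2" and sm: "smooth_H2 \<delta> U"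
    using bc by (auto simp: bifurcation_curve_def Y_rev_def)
  have U0: "U 0 \<eta> = 0" for \<eta> using bc by (auto simp: bifurcation_curve_def)
  obtain D where D: "D 0 = U" "\<And>j t. \<bar>t\<bar> < \<delta> \<Longrightarrow> D j t \<in> H2"
    "\<And>j t. \<bar>t\<bar> < \<delta> \<Longrightarrow> ((\<lambda>h. H2_dist (\<lambda>\<eta>. (1 / h) *\<^sub>R (D j (t + h) \<eta> - D j t \<eta>)) (D (Suc j) t)) \<longlongrightarrow> 0) (at 0)"
    using sm unfolding smooth_H2_def by blast
  define V where "V = D (Suc 0) 0"
  have V: "V \<in> H2" using D(2)[of 0 "Suc 0"] \<delta> by (simp add: V_def)
  have "((\<lambda>h. H2_dist (\<lambda>\<eta>. (1 / h) *\<^sub>R U h \<eta>) V) \<longlongrightarrow> 0) (at 0)"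
    using D(3)[of 0 0] \<delta> by (simp add: D(1) V_def U0)
  then have "eventually (\<lambda>h. H2_dist (\<lambda>\<eta>. (1 / h) *\<^sub>R U h \<eta>) V < 1) (at 0)"
    by (rule order_tendstoD) simp
  then obtain d where d: "d > 0" "\<And>h. h \<noteq> 0 \<Longrightarrow> \<bar>h\<bar> < d \<Longrightarrow> H2_dist (\<lambda>\<eta>. (1 / h) *\<^sub>R U h \<eta>) V < 1"
    by (auto simp: eventually_at dist_real_def)
  \<comment> \<open>The first 5 bounds \<open>U t / t - V\<close>, whose H2 norm is below 1; the
    rest bounds \<open>V\<close>, with \<open>+ 1\<close> to satisfy the strict hypothesis of
    \<open>H2_sup_bound\<close>.\<close>
  define K where "K = 5 + 5 * (H2_norm V + 1)"
  show thesis
  proof (rule that[of "min d \<delta>" K])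
    show "min d \<delta> > 0" using d \<delta> by simp
    fix t \<eta> :: real assume t: "t \<noteq> 0" "\<bar>t\<bar> < min d \<delta>"
    define W where "W = (\<lambda>\<eta>. (1 / t) *\<^sub>R U t \<eta>)"
    have U: "U t \<in> H2" using UH t by simp
    have W: "W \<in> H2" using H2_lincomb[OF U U, of "1 / t" 0] by (simp add: W_def)
    have vW: "vd W \<eta> = (1 / t) *\<^sub>R vd (U t) \<eta>"
      using has_second_deriv_lincomb(2)[OF H2_d2[OF U] H2_d2[OF U], of "1 / t" 0] by (simp add: W_def)
    have vWV: "vd (\<lambda>\<eta>. W \<eta> - V \<eta>) \<eta> = vd W \<eta> - vd V \<eta>"
      using has_second_deriv_lincomb(2)[OF H2_d2[OF W] H2_d2[OF V], of 1 "-1"] by simp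
    have n: "H2_norm (\<lambda>\<eta>. W \<eta> - V \<eta>) < 1" using d(2)[of t] t by (simp add: H2_dist_def W_def)
    have "norm (W \<eta> - V \<eta>) \<le> 5" "norm (vd W \<eta> - vd V \<eta>) \<le> 5"
      using H2_sup_bound[OF H2_diff[OF W V] n, of \<eta>] by (simp_all add: vWV)
    moreover have "norm (V \<eta>) \<le> 5 * (H2_norm V + 1)" "norm (vd V \<eta>) \<le> 5 * (H2_norm V + 1)"
      using H2_sup_bound[OF V, of "H2_norm V + 1" \<eta>] by simp_all
    ultimately have "norm (W \<eta>) \<le> K" "norm (vd W \<eta>) \<le> K"
      unfolding K_def using norm_triangle_sub[of "W \<eta>" "V \<eta>"] norm_triangle_sub[of "vd W \<eta>" "vd V \<eta>"] by linarith+
    then have "norm (W \<eta>) * \<bar>t\<bar> \<le> K * \<bar>t\<bar>" "norm (vd W \<eta>) * \<bar>t\<bar> \<le> K * \<bar>t\<bar>"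
      by (auto intro: mult_right_mono)
    moreover have "norm (W \<eta>) * \<bar>t\<bar> = norm (U t \<eta>)" using t(1) by (simp add: W_def)
    moreover have "norm (vd W \<eta>) * \<bar>t\<bar> = norm (vd (U t) \<eta>)" using t(1) by (simp add: vW)
    ultimately show "norm (U t \<eta>) \<le> K * \<bar>t\<bar> \<and> norm (vd (U t) \<eta>) \<le> K * \<bar>t\<bar>"
      by simp
  qed
qed

text \<open>The threshold must serve all phases at once. A sequence of counterexamples may have
  arbitrary phases, but by the linear bound it still tends to 0 uniformly with its velocities, and
  the equator has degree 1.\<close>

lemma bifurcation_curve_degree:
  assumes R: "R > 0" and bc: "bifurcation_curve R k \<delta> L U"
  obtains \<epsilon> where "0 < \<epsilon>" "\<epsilon> \<le> \<delta>"
    "\<And>t \<phi>. t \<noteq> 0 \<Longrightarrow> \<bar>t\<bar> < \<epsilon> \<Longrightarrow> (L t, phase_translate \<phi> (U t)) \<in> Zreg R \<Longrightarrow> horizontal_degree R (phase_translate \<phi> (U t)) = 1"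
proof -
  have \<delta>: "\<delta> > 0" and UH: "\<And>t. \<bar>t\<bar> < \<delta> \<Longrightarrow> U t \<in> H2"
    using bc by (auto simp: bifurcation_curve_def Y_rev_def)
  obtain K d where d: "d > 0"
    and K: "\<And>t \<eta>. t \<noteq> 0 \<Longrightarrow> \<bar>t\<bar> < d \<Longrightarrow> norm (U t \<eta>) \<le> K * \<bar>t\<bar> \<and> norm (vd (U t) \<eta>) \<le> K * \<bar>t\<bar>"
    by (rule bifurcation_curve_small[OF bc]) blast
  define d' where "d' = min d \<delta>"
  have d': "d' > 0" using d \<delta> by (simp add: d'_def)
  have "\<exists>\<epsilon>. 0 < \<epsilon> \<and> \<epsilon> \<le> d' \<and> (\<forall>t \<phi>. t \<noteq> 0 \<longrightarrow> \<bar>t\<bar> < \<epsilon> \<longrightarrow> (L t, phase_translate \<phi> (U t)) \<in> Zreg R \<longrightarrow> horizontal_degree R (phase_translate \<phi> (U t)) = 1)"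
  proof (rule ccontr)
    assume neg: "\<not> ?thesis"
    have "\<exists>t \<phi>. t \<noteq> 0 \<and> \<bar>t\<bar> < min d' (inverse (real (Suc n))) \<and> (L t, phase_translate \<phi> (U t)) \<in> Zreg R \<and> horizontal_degree R (phase_translate \<phi> (U t)) \<noteq> 1" for n
    proof -
      have "0 < min d' (inverse (real (Suc n)))" "min d' (inverse (real (Suc n))) \<le> d'" using d' by auto
      then show ?thesis using neg by blast
    qed
    then obtain ts \<phi>s where t: "\<And>n. ts n \<noteq> 0" "\<And>n. \<bar>ts n\<bar> < min d' (inverse (real (Suc n)))"
      "\<And>n. (L (ts n), phase_translate (\<phi>s n) (U (ts n))) \<in> Zreg R"
      "\<And>n. horizontal_degree R (phase_translate (\<phi>s n) (U (ts n))) \<noteq> 1"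
      by metis
    define us where "us = (\<lambda>n. phase_translate (\<phi>s n) (U (ts n)))"
    have us: "us n \<in> H2" for n using Zreg_H2[OF t(3)] by (simp add: us_def)
    have nz: "(orbit R (us n) t $ 1)\<^sup>2 + (orbit R (us n) t $ 2)\<^sup>2 \<noteq> 0" for n t
      using Zreg_horizontal_nonzero[OF R t(3)] by (simp add: us_def)
    have lt: "\<bar>ts n\<bar> < d" "\<bar>ts n\<bar> < \<delta>" "\<bar>ts n\<bar> \<le> inverse (real (Suc n))" for n
      using t(2)[of n] by (auto simp: d'_def)
    have "(\<lambda>n. \<bar>ts n\<bar>) \<longlonglongrightarrow> 0"
      by (rule tendsto_sandwich[OF _ _ tendsto_const LIMSEQ_inverse_real_of_nat]) (use lt(3) in auto)
    then have Klim: "(\<lambda>n. K * \<bar>ts n\<bar>) \<longlonglongrightarrow> 0" by (rule tendsto_mult_right_zero)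
    \<comment> \<open>A phase translate combines a shift with a rotation, which preserves norms, so
      the bound at every angle is independent of the phase.\<close>
    have bound: "norm (us n \<eta>) \<le> K * \<bar>ts n\<bar>" "norm (vd (us n) \<eta>) \<le> K * \<bar>ts n\<bar>" for n \<eta>
      using K[OF t(1) lt(1)] UH[OF lt(2)] by (simp_all add: us_def vd_phase_translate norm_rot, simp add: phase_translate_def norm_rot)
    have ev: "eventually (\<lambda>n. K * \<bar>ts n\<bar> < e) sequentially" if "e > 0" for e
      using order_tendstoD(2)[OF Klim that] .
    have vd0: "vd (\<lambda>_. 0) = (\<lambda>_. 0)" by simp
    have H0: "(\<lambda>_. 0) \<in> H2" using H2_diff[OF us[of 0] us[of 0]] by simp
    have "(\<lambda>n. horizontal_degree R (us n)) \<longlonglongrightarrow> horizontal_degree R (\<lambda>_. 0)"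
    proof (rule horizontal_degree_tendsto[OF us nz H0])
      show "(orbit R (\<lambda>_. 0) t $ 1)\<^sup>2 + (orbit R (\<lambda>_. 0) t $ 2)\<^sup>2 \<noteq> 0" for t
        using R by (auto simp: orbit_def x0_def sum_power2_eq_zero_iff) (metis sin_zero_abs_cos_one abs_zero zero_neq_one)
      show "uniform_limit {0..2*pi} us (\<lambda>_. 0) sequentially"
        by (rule uniform_limitI) (auto elim!: eventually_mono[OF ev] intro: le_less_trans[OF bound(1)])
      show "uniform_limit {0..2*pi} (\<lambda>n. vd (us n)) (vd (\<lambda>_. 0)) sequentially"
        unfolding vd0
        by (rule uniform_limitI) (auto elim!: eventually_mono[OF ev] intro: le_less_trans[OF bound(2)])
    qed
    then have "(\<lambda>n. horizontal_degree R (us n)) \<longlonglongrightarrow> 1" using horizontal_degree_0[OF R] by simp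
    then have "\<forall>\<^sub>F n in sequentially. horizontal_degree R (us n) = 1"
      by (rule Ints_eventually_eq) (use horizontal_degree_Ints[OF us nz] in auto)
    then show False using t(4) by (simp add: us_def)
  qed
  then obtain \<epsilon> where "0 < \<epsilon>" "\<epsilon> \<le> d'" "\<And>t \<phi>. t \<noteq> 0 \<Longrightarrow> \<bar>t\<bar> < \<epsilon> \<Longrightarrow> (L t, phase_translate \<phi> (U t)) \<in> Zreg R \<Longrightarrow> horizontal_degree R (phase_translate \<phi> (U t)) = 1"
    by blast
  then show thesis by (intro that[of \<epsilon>]) (auto simp: d'_def)
qed

section \<open>Limits of degree-one sequences and the final assembly\<close>

text \<open>After collapse both root sequences tend to the constant height. A pole value would be
  one of the excluded contact alternatives, so the limit stays off the axis and inherits degree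
  1.\<close>

lemma degree_one_boundary:
  assumes R: "R > 0" and bs: "boundary_sequence R ls us l u e1 e2 e3"
    and deg: "\<And>n. horizontal_degree R (us n) = 1" and r: "strict_mono r"
    and col: "alt_collapse R l u (e1 \<circ> r) (e2 \<circ> r)"
    and ns: "\<not> alt_south R l u (e1 \<circ> r)" and nn: "\<not> alt_north R l u (e2 \<circ> r)"
  shows "\<forall>\<eta>. orbit R u \<eta> $ 3 = 0" "\<exists>\<phi>. (l, rotate_orbit R \<phi> u) \<in> equatorial_branch"
proof -
  interpret zero_set_solution R l u by unfold_locales (use R bs in \<open>auto simp: boundary_sequence_def\<close>)
  note alts = boundary_sequence_alternatives[OF R bs]
  obtain u0 where u0: "- R \<le> u0" "u0 \<le> R" "\<And>t. x t $ 3 = u0"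
    using col by (auto simp: alt_collapse_def)
  have e: "(e1 \<circ> r) \<longlonglongrightarrow> u0" "(e2 \<circ> r) \<longlonglongrightarrow> u0"
    using alts(6)[of u0] alts(7)[of u0] u0 LIMSEQ_subseq_LIMSEQ[OF _ r]
    by (auto simp: is_min_of_def is_max_of_def)
  have "u0 \<noteq> - R" using alts(1)[OF r] e(1) ns by auto
  moreover have "u0 \<noteq> R" using alts(2)[OF r] e(2) nn by auto
  ultimately have abs: "\<bar>u0\<bar> < R" using u0 by auto
  have reg: "(ls n, us n) \<in> Zreg R" for n using bs by (auto simp: boundary_sequence_def)
  have lim: "(\<lambda>n. H2_dist (us n) u) \<longlonglongrightarrow> 0" using bs by (simp add: boundary_sequence_def)
  note us = Zreg_H2[OF reg]
  have "(\<lambda>n. horizontal_degree R (us n)) \<longlonglongrightarrow> horizontal_degree R u"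
    by (intro horizontal_degree_tendsto us u_H2 Zreg_horizontal_nonzero[OF R reg] 
        H2_dist_imp_uniform_limit[OF us u_H2 lim] horizontal_nonzero) (use u0 abs in simp)
  then have "horizontal_degree R u = 1" using LIMSEQ_unique[OF _ tendsto_const] by (simp add: deg)
  from latitude_degree_one[OF u0(3) abs this] u0(3)
  show "\<forall>\<eta>. orbit R u \<eta> $ 3 = 0" "\<exists>\<phi>. (l, rotate_orbit R \<phi> u) \<in> equatorial_branch" by auto
qed

theorem proposition4p3:
  fixes R :: real
  assumes "R > 0"
  shows
    "(\<forall>ls us l u e1 e2 e3. boundary_sequence R ls us l u e1 e2 e3 \<longrightarrow>
        (\<exists>r. strict_mono r \<and>
           (alt_south R l u (e1 \<circ> r) \<or> alt_north R l u (e2 \<circ> r) \<or>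
            alt_collapse R l u (e1 \<circ> r) (e2 \<circ> r) \<or>
            alt_double_root R l u (e1 \<circ> r) (e2 \<circ> r) (e3 \<circ> r))) \<and>
        (\<forall>r. strict_mono r \<longrightarrow>
           ((e1 \<circ> r) \<longlonglongrightarrow> - R \<longrightarrow> alt_south R l u (e1 \<circ> r)) \<and>
           ((e2 \<circ> r) \<longlonglongrightarrow> R \<longrightarrow> alt_north R l u (e2 \<circ> r)) \<and>
           ((\<lambda>n. e2 (r n) - e1 (r n)) \<longlonglongrightarrow> 0 \<longrightarrow> alt_collapse R l u (e1 \<circ> r) (e2 \<circ> r)) \<and>
           ((\<lambda>n. e3 (r n) - e2 (r n)) \<longlonglongrightarrow> 0 \<longrightarrow>
              alt_double_root R l u (e1 \<circ> r) (e2 \<circ> r) (e3 \<circ> r))) \<and>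
        ((\<exists>q. \<forall>n. is_nodal_number R (us n) q) \<and> bounded (range ls) \<longrightarrow>
           (\<forall>r. strict_mono r \<longrightarrow> alt_double_root R l u (e1 \<circ> r) (e2 \<circ> r) (e3 \<circ> r) \<longrightarrow>
              alt_collapse R l u (e1 \<circ> r) (e2 \<circ> r))))
   \<and> (\<forall>ls us e1 e2 e3.
        (\<forall>n. (ls n, us n) \<in> Zreg R \<and> assoc_roots R (ls n) (us n) (e1 n) (e2 n) (e3 n)) \<and>
        (\<exists>q. \<forall>n. is_nodal_number R (us n) q) \<and> bounded (range ls) \<and>
        (\<lambda>n. e3 n - e2 n) \<longlonglongrightarrow> 0 \<longrightarrow> (\<lambda>n. e2 n - e1 n) \<longlonglongrightarrow> 0)
   \<and> (\<forall>k \<delta> L U. k \<ge> 2 \<and> bifurcation_curve R k \<delta> L U \<longrightarrow>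
        (\<exists>\<epsilon>. 0 < \<epsilon> \<and> \<epsilon> \<le> \<delta> \<and>
          (\<forall>B. regular_branch R L U \<epsilon> B \<longrightarrow>
             (\<forall>(l, u) \<in> B. horizontal_degree R u = 1) \<and>
             (\<forall>ls us l u e1 e2 e3.
                boundary_sequence R ls us l u e1 e2 e3 \<and> (\<forall>n. (ls n, us n) \<in> B) \<longrightarrow>
                (\<forall>r. strict_mono r \<longrightarrow>
                   alt_collapse R l u (e1 \<circ> r) (e2 \<circ> r) \<and>
                   \<not> alt_south R l u (e1 \<circ> r) \<and> \<not> alt_north R l u (e2 \<circ> r) \<longrightarrow>
                   (\<forall>\<eta>. orbit R u \<eta> $ 3 = 0)) \<and>
                (bounded (range ls) \<longrightarrow>
                   (\<exists>r. strict_mono r \<and>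
                      (alt_south R l u (e1 \<circ> r) \<or> alt_north R l u (e2 \<circ> r) \<or>
                       (alt_collapse R l u (e1 \<circ> r) (e2 \<circ> r) \<and>
                        (\<exists>\<phi>. (l, rotate_orbit R \<phi> u) \<in> equatorial_branch)))))))))"
proof (intro conjI allI impI)
  fix ls us l u e1 e2 e3
  assume bs: "boundary_sequence R ls us l u e1 e2 e3"
  note alts = boundary_sequence_alternatives[OF assms bs]
  show "\<exists>r. strict_mono r \<and>
       (alt_south R l u (e1 \<circ> r) \<or> alt_north R l u (e2 \<circ> r) \<or>
        alt_collapse R l u (e1 \<circ> r) (e2 \<circ> r) \<or>
        alt_double_root R l u (e1 \<circ> r) (e2 \<circ> r) (e3 \<circ> r))"
    \<comment> \<open>The identity serves as subsequence, because the roots converge along the whole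
      sequence.\<close>
    using alts(1-3)[of id] alts(5) by (intro exI[of _ id]) (auto simp: strict_mono_id)
  fix r :: "nat \<Rightarrow> nat" assume r: "strict_mono r"
  show "alt_south R l u (e1 \<circ> r)" if "(e1 \<circ> r) \<longlonglongrightarrow> - R" using alts(1)[OF r that] .
  show "alt_north R l u (e2 \<circ> r)" if "(e2 \<circ> r) \<longlonglongrightarrow> R" using alts(2)[OF r that] .
  show "alt_collapse R l u (e1 \<circ> r) (e2 \<circ> r)" if "(\<lambda>n. e2 (r n) - e1 (r n)) \<longlonglongrightarrow> 0" using alts(3)[OF r that] .
  show "alt_double_root R l u (e1 \<circ> r) (e2 \<circ> r) (e3 \<circ> r)" if "(\<lambda>n. e3 (r n) - e2 (r n)) \<longlonglongrightarrow> 0"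
    \<comment> \<open>The separatrix clause holds because its premise fails: by
      \<open>alts(4)\<close> the closing upper gap forces the lower gap to close.\<close>
    using alts(4)[OF r that] that by (simp add: alt_double_root_def o_def)
  show "alt_collapse R l u (e1 \<circ> r) (e2 \<circ> r)" if "alt_double_root R l u (e1 \<circ> r) (e2 \<circ> r) (e3 \<circ> r)"
    using alts(3)[OF r alts(4)[OF r]] that by (simp add: alt_double_root_def o_def)
next
  fix ls us e1 e2 e3
  assume *: "(\<forall>n. (ls n, us n) \<in> Zreg R \<and> assoc_roots R (ls n) (us n) (e1 n) (e2 n) (e3 n)) \<and>
     (\<exists>q. \<forall>n. is_nodal_number R (us n) q) \<and> bounded (range ls) \<and> (\<lambda>n. e3 n - e2 n) \<longlonglongrightarrow> 0"
  then have "(ls n, us n) \<in> Z R" for n by (auto simp: Zreg_def)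
  then show "(\<lambda>n. e2 n - e1 n) \<longlonglongrightarrow> 0" using root_gap_collapse[OF assms] * by blast
next
  fix k \<delta> L U assume "k \<ge> 2 \<and> bifurcation_curve R k \<delta> L U"
  then have bc: "bifurcation_curve R k \<delta> L U" by simp
  obtain \<epsilon> where \<epsilon>: "0 < \<epsilon>" "\<epsilon> \<le> \<delta>"
    "\<And>t \<phi>. t \<noteq> 0 \<Longrightarrow> \<bar>t\<bar> < \<epsilon> \<Longrightarrow> (L t, phase_translate \<phi> (U t)) \<in> Zreg R \<Longrightarrow> horizontal_degree R (phase_translate \<phi> (U t)) = 1"
    using bifurcation_curve_degree[OF assms bc] by blast
  \<comment> \<open>The degree is 1 at the point of the curve, or its phase translate, through which
    the component passes, and it is constant on the component.\<close>
  have deg: "horizontal_degree R u = 1" if B: "regular_branch R L U \<epsilon> B" and u: "(l, u) \<in> B" for B l u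
  proof -
    have comp: "B \<in> connected_components_of (subtopology pair_topology (Zreg R))"
      using B by (simp add: regular_branch_def)
    obtain t \<phi> where t: "t \<noteq> 0" "\<bar>t\<bar> < \<epsilon>" "(L t, phase_translate \<phi> (U t)) \<in> B"
      using B by (auto simp: regular_branch_def)
    have "B \<subseteq> Zreg R" using connected_components_of_subset[OF comp] by simp
    then have "horizontal_degree R (phase_translate \<phi> (U t)) = 1" using \<epsilon>(3) t by blast
    then show ?thesis using horizontal_degree_component[OF assms comp u t(3)] by simp
  qed
  show "\<exists>\<epsilon>. 0 < \<epsilon> \<and> \<epsilon> \<le> \<delta> \<and>
          (\<forall>B. regular_branch R L U \<epsilon> B \<longrightarrow>
             (\<forall>(l, u) \<in> B. horizontal_degree R u = 1) \<and>
             (\<forall>ls us l u e1 e2 e3.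
                boundary_sequence R ls us l u e1 e2 e3 \<and> (\<forall>n. (ls n, us n) \<in> B) \<longrightarrow>
                (\<forall>r. strict_mono r \<longrightarrow>
                   alt_collapse R l u (e1 \<circ> r) (e2 \<circ> r) \<and>
                   \<not> alt_south R l u (e1 \<circ> r) \<and> \<not> alt_north R l u (e2 \<circ> r) \<longrightarrow>
                   (\<forall>\<eta>. orbit R u \<eta> $ 3 = 0)) \<and>
                (bounded (range ls) \<longrightarrow>
                   (\<exists>r. strict_mono r \<and>
                      (alt_south R l u (e1 \<circ> r) \<or> alt_north R l u (e2 \<circ> r) \<or>
                       (alt_collapse R l u (e1 \<circ> r) (e2 \<circ> r) \<and>
                        (\<exists>\<phi>. (l, rotate_orbit R \<phi> u) \<in> equatorial_branch)))))))"
  proof (intro exI[of _ \<epsilon>] conjI \<epsilon>(1,2) allI impI)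
    fix B assume B: "regular_branch R L U \<epsilon> B"
    show "\<forall>(l, u)\<in>B. horizontal_degree R u = 1" using deg[OF B] by blast
    fix ls us l u e1 e2 e3
    assume "boundary_sequence R ls us l u e1 e2 e3 \<and> (\<forall>n. (ls n, us n) \<in> B)"
    then have bs: "boundary_sequence R ls us l u e1 e2 e3" and d: "\<And>n. horizontal_degree R (us n) = 1"
      using deg[OF B] by auto
    note alts = boundary_sequence_alternatives[OF assms bs]
    show "orbit R u \<eta> $ 3 = 0" if "strict_mono r" 
      "alt_collapse R l u (e1 \<circ> r) (e2 \<circ> r) \<and> \<not> alt_south R l u (e1 \<circ> r) \<and> \<not> alt_north R l u (e2 \<circ> r)" for r \<eta>
      using degree_one_boundary(1)[OF assms bs d that(1)] that(2) by blast
    show "\<exists>r. strict_mono r \<and>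
            (alt_south R l u (e1 \<circ> r) \<or> alt_north R l u (e2 \<circ> r) \<or>
             (alt_collapse R l u (e1 \<circ> r) (e2 \<circ> r) \<and> (\<exists>\<phi>. (l, rotate_orbit R \<phi> u) \<in> equatorial_branch)))"
      using alts(1-3)[of id] alts(5) degree_one_boundary(2)[OF assms bs d strict_mono_id]
      by (intro exI[of _ id]) (auto simp: strict_mono_id)
  qed
qed

end
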